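(* Let $\mathcal{B}$ be a uniform body whose material groupoid $\Omega(\mathcal{B})$ is a Lie subgroupoid of $\Pi^1(\mathcal{B},\mathcal{B})$. Then $\mathcal{B}$ is locally homogeneous if and only if for each point $x\in\mathcal{B}$ there exists a local coordinate system $(x^i)$ over an open set $U\subseteq\mathcal{B}$ with $x\in U$ such that the local section of $\sharp$ $$\Delta\left(x^i,\frac{\partial}{\partial x^i}\right)=\left(x^i,\frac{\partial}{\partial x^i},0\right)$$ takes values in the material algebroid $A\Omega(\mathcal{B})$.
   Context: 1-jets groupoid: for a manifold $M$, $\Pi^1(M,M)$ is the set of 1-jets $j^1_{x,y}\phi$ of local diffeomorphisms $\phi$ of $M$ with $\phi(x)=y$; it is a Lie groupoid over $M$ with source $\alpha(j^1_{x,y}\phi)=x$, target $\beta(j^1_{x,y}\phi)=y$, identities $\epsilon(x)=j^1_{x,x}\mathrm{Id}$ and composition of jets. Local coordinates $(x^i)$ on $U$ and $(y^j)$ on $V$ induce coordinates $(x^i,y^j,y^j_i)$ on $(\alpha,\beta)^{-1}(U\times V)$, with $y^j_i(j^1_{x,y}\psi)=\partial(y^j\circ\psi)/\partial x^i|_x$. Body: a three-dimensional manifold $\mathcal{B}$ which can be covered by one chart, identified with an open subset of $\mathbb{R}^3$ by a fixed embedding (reference configuration). A deformation is an embedding $\kappa:\mathcal{B}\to\mathbb{R}^3$; an infinitesimal deformation at $Y$ is its 1-jet $j^1_{Y,\kappa(Y)}\kappa$. The body is equipped with a response functional: a differentiable map $W:\Pi^1(\mathcal{B},\mathcal{B})\to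 V$, $V$ a real vector space, such that $W(j^1_{X,Y}\phi)=W(j^1_{X,Z}(\tau_{Z-Y}\circ\phi))$ for all $X,Y,Z\in\mathcal{B}$ and all $j^1_{X,Y}\phi$, where $\tau_v$ is translation of $\mathbb{R}^3$ by $v$. By this invariance $W$ extends to 1-jets of local diffeomorphisms from points of $\mathcal{B}$ to points of $\mathbb{R}^3$. Material isomorphism: a jet $j^1_{X,Y}\psi\in\Pi^1(\mathcal{B},\mathcal{B})$ with $W(j^1_{Y,\kappa(Y)}\kappa\cdot j^1_{X,Y}\psi)=W(j^1_{Y,\kappa(Y)}\kappa)$ for every infinitesimal deformation $j^1_{Y,\kappa(Y)}\kappa$ at $Y$. $\Omega(\mathcal{B})\subseteq\Pi^1(\mathcal{B},\mathcal{B})$ is the subgroupoid (over $\mathcal{B}$) of all material isomorphisms. $\mathcal{B}$ is uniform if for all $X,Y\in\mathcal{B}$ there is a material isomorphism from $X$ to $Y$. Standing assumption: $\Omega(\mathcal{B})$ is a Lie subgroupoid of $\Pi^1(\mathcal{B},\mathcal{B})$; it is called the material groupoid. Homogeneity: $\mathcal{B}$ is homogeneous if there is a (global) deformation $\kappa$ such that for all $X,Y\in\mathcal{B}$ the jet $P(X,Y)=j^1_{X,Y}(\kappa^{-1}\circ\tau_{\kappa(Y)-\kappa(X)}\circ\kappa)$ belongs to $\Omega(\mathcal{B})$. $\mathcal{B}$ is locally homogeneous if it is covered by open subsets which are homogeneous (as bodies, with the restricted response functional). Lie algebroid of a Lie groupoid $\Gamma\rightrightarrows M$: the vector bundle $A\Gamma\to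 M$ with fibre $\ker T_{\epsilon(x)}\beta$ at $x$, with anchor $\sharp=T\alpha|_{A\Gamma}:A\Gamma\to TM$ and with the bracket of sections induced by identifying sections with left-invariant vector fields on $\Gamma$. The material algebroid is $A\Omega(\mathcal{B})\subseteq A\Pi^1(\mathcal{B},\mathcal{B})$. A local coordinate system $(x^i)$ on $U$ induces coordinates $(x^i,v^i,v^j_i)$ on $A\Pi^1(U,U)$, the triple representing $v^i\frac{\partial}{\partial x^i}+v^j_i\frac{\partial}{\partial y^j_i}$ at $\epsilon(x)$; then $\sharp(x^i,v^i,v^j_i)=(x^i,v^i)$. The section $\Delta$ in the claim is the fibre-wise linear section $TU\to A\Pi^1(U,U)$ of $\sharp$ given by $(x^i,v^i)\mapsto(x^i,v^i,0)$. *)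

theory Defs
  imports "HOL-Analysis.Analysis"
begin

section \<open>Smooth maps\<close>

text \<open>For an open set in a finite-dimensional space, \<open>Ck_on k\<close> is the usual class of
  \<open>k\<close> times continuously differentiable maps.\<close>

primrec Ck_on :: "nat \<Rightarrow> 'a::real_normed_vector set \<Rightarrow> ('a \<Rightarrow> 'b::real_normed_vector) \<Rightarrow> bool"
where
  "Ck_on 0 S f \<longleftrightarrow> continuous_on S f"
| "Ck_on (Suc k) S f \<longleftrightarrow>
     (\<forall>x\<in>S. f differentiable (at x)) \<and>
     (\<forall>v. Ck_on k S (\<lambda>x. frechet_derivative f (at x) v))"

text \<open>Smoothness on an arbitrary subset means existence of local smooth extensions. On an open
  set this is being of class \<open>C\<^sup>\<infinity>\<close>, on an embedded submanifold it is smoothness with respect to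
  the submanifold structure.\<close>

definition smooth_on :: "'a::real_normed_vector set \<Rightarrow> ('a \<Rightarrow> 'b::real_normed_vector) \<Rightarrow> bool" where
  "smooth_on S f \<longleftrightarrow>
     (\<forall>x\<in>S. \<exists>N g. open N \<and> x \<in> N \<and> (\<forall>k. Ck_on k N g) \<and> (\<forall>y\<in>S \<inter> N. g y = f y))"

text \<open>Diffeomorphisms from an open set onto an open set.\<close>

definition diffeo_on :: "'a::euclidean_space set \<Rightarrow> ('a \<Rightarrow> 'a) \<Rightarrow> bool" where
  "diffeo_on U \<phi> \<longleftrightarrow>
     open U \<and> inj_on \<phi> U \<and> smooth_on U \<phi> \<and> open (\<phi> ` U) \<and> smooth_on (\<phi> ` U) (inv_into U \<phi>)"

definition translation :: "'a::real_normed_vector \<Rightarrow> 'a \<Rightarrow> 'a" where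
  "translation v x = x + v"


section \<open>The groupoid of 1-jets\<close>

text \<open>Over open subsets of \<open>\<real>\<^sup>3\<close> the 1-jet of a map at a point is determined by the point, its
  image and the Jacobian matrix there, so that jets are represented by their standard
  coordinates \<open>(x, y, (y\<^sup>j\<^sub>i))\<close>. The ambient space is Euclidean, and it is also the tangent space
  of \<open>Pi1 M N\<close>, which is open in it, at each point.\<close>

type_synonym jet = "(real^3) \<times> (real^3) \<times> (real^3^3)"

definition jacobi :: "(real^3 \<Rightarrow> real^3) \<Rightarrow> real^3 \<Rightarrow> real^3^3" where
  "jacobi \<phi> x = matrix (frechet_derivative \<phi> (at x))"

definition jet1 :: "(real^3 \<Rightarrow> real^3) \<Rightarrow> real^3 \<Rightarrow> jet" where
  "jet1 \<phi> x = (x, \<phi> x, jacobi \<phi> x)"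

definition Pi1 :: "(real^3) set \<Rightarrow> (real^3) set \<Rightarrow> jet set" where
  "Pi1 M N = {jet1 \<phi> x | \<phi> x U. diffeo_on U \<phi> \<and> x \<in> U \<and> U \<subseteq> M \<and> \<phi> ` U \<subseteq> N}"

fun source :: "jet \<Rightarrow> real^3" where
  "source (x, y, A) = x"

fun target :: "jet \<Rightarrow> real^3" where
  "target (x, y, A) = y"

definition ident :: "real^3 \<Rightarrow> jet" where
  "ident x = jet1 id x"

text \<open>\<open>jet_comp j k\<close> is the composition of jets \<open>j \<cdot> k\<close>; it is only meaningful when
  \<open>source j = target k\<close>.\<close>

fun jet_comp :: "jet \<Rightarrow> jet \<Rightarrow> jet" where
  "jet_comp (y, z, B) (x, y', A) = (x, z, B ** A)"

fun jet_inv :: "jet \<Rightarrow> jet" where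
  "jet_inv (x, y, A) = (y, x, matrix_inv A)"


section \<open>Bodies, material isomorphisms, uniformity and homogeneity\<close>

definition body :: "(real^3) set \<Rightarrow> (jet \<Rightarrow> 'v::real_normed_vector) \<Rightarrow> bool" where
  "body \<B> W \<longleftrightarrow>
     open \<B> \<and> W differentiable_on Pi1 \<B> \<B> \<and>
     (\<forall>\<phi> U X Z. diffeo_on U \<phi> \<and> X \<in> U \<and> U \<subseteq> \<B> \<and> \<phi> ` U \<subseteq> \<B> \<and> Z \<in> \<B> \<longrightarrow>
        W (jet1 \<phi> X) = W (jet1 (translation (Z - \<phi> X) \<circ> \<phi>) X))"

text \<open>The extension of \<open>W\<close> to jets with target anywhere in \<open>\<real>\<^sup>3\<close>: the target is translated into
  the body. The source is used as the new target; by translation invariance every other point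
  of the body gives the same value. A translation does not change the Jacobian matrix.\<close>

fun extend :: "(jet \<Rightarrow> 'v) \<Rightarrow> jet \<Rightarrow> 'v" where
  "extend W (X, y, A) = W (X, X, A)"

text \<open>Embeddings into \<open>\<real>\<^sup>3\<close>, i.e. diffeomorphisms onto submanifolds of \<open>\<real>\<^sup>3\<close>, which are open
  subsets because the dimensions agree.\<close>

definition deformation :: "(real^3) set \<Rightarrow> (real^3 \<Rightarrow> real^3) \<Rightarrow> bool" where
  "deformation \<B> \<kappa> \<longleftrightarrow> diffeo_on \<B> \<kappa>"

definition material_isomorphism :: "(real^3) set \<Rightarrow> (jet \<Rightarrow> 'v) \<Rightarrow> jet \<Rightarrow> bool" where
  "material_isomorphism \<B> W j \<longleftrightarrow>
     j \<in> Pi1 \<B> \<B> \<and>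
     (\<forall>\<kappa>. deformation \<B> \<kappa> \<longrightarrow>
        extend W (jet_comp (jet1 \<kappa> (target j)) j) = extend W (jet1 \<kappa> (target j)))"

definition material_groupoid :: "(real^3) set \<Rightarrow> (jet \<Rightarrow> 'v) \<Rightarrow> jet set" where
  "material_groupoid \<B> W = {j. material_isomorphism \<B> W j}"

definition uniform :: "(real^3) set \<Rightarrow> (jet \<Rightarrow> 'v) \<Rightarrow> bool" where
  "uniform \<B> W \<longleftrightarrow>
     (\<forall>X\<in>\<B>. \<forall>Y\<in>\<B>. \<exists>j. material_isomorphism \<B> W j \<and> source j = X \<and> target j = Y)"

definition homogeneous :: "(real^3) set \<Rightarrow> (jet \<Rightarrow> 'v) \<Rightarrow> bool" where
  "homogeneous \<B> W \<longleftrightarrow>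
     (\<exists>\<kappa>. deformation \<B> \<kappa> \<and>
        (\<forall>X\<in>\<B>. \<forall>Y\<in>\<B>.
           jet1 (inv_into \<B> \<kappa> \<circ> translation (\<kappa> Y - \<kappa> X) \<circ> \<kappa>) X \<in> material_groupoid \<B> W))"

text \<open>For \<open>U \<subseteq> \<B>\<close>, \<open>homogeneous U W\<close> only involves the values of \<open>W\<close> on \<open>Pi1 U U\<close>.\<close>

definition locally_homogeneous :: "(real^3) set \<Rightarrow> (jet \<Rightarrow> 'v) \<Rightarrow> bool" where
  "locally_homogeneous \<B> W \<longleftrightarrow>
     (\<exists>\<U>. \<Union>\<U> = \<B> \<and> (\<forall>U\<in>\<U>. open U \<and> homogeneous U W))"


section \<open>Lie subgroupoids and their Lie algebroids\<close>

text \<open>A smooth structure on a subset \<open>G\<close> of the space of jets is given by an atlas \<open>\<A>\<close> of local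
  parametrisations \<open>(D, p)\<close>, the inverses \<open>p\<close> of charts, defined on open subsets \<open>D\<close> of a
  Euclidean space \<open>'d\<close>. Its topology is the one for which the sets \<open>p ` D'\<close>, for \<open>D' \<subseteq> D\<close>
  open, are a base; it may be finer than the subspace topology. \<open>smooth_into \<A> S f\<close> says that
  \<open>f\<close> is smooth as a map from \<open>S\<close> into this manifold.\<close>

type_synonym 'd atlas = "('d set \<times> ('d \<Rightarrow> jet)) set"

definition smooth_into ::
  "('d::euclidean_space) atlas \<Rightarrow> ('a::euclidean_space) set \<Rightarrow> ('a \<Rightarrow> jet) \<Rightarrow> bool" where
  "smooth_into \<A> S f \<longleftrightarrow>
     (\<forall>(D, p)\<in>\<A>. openin (top_of_set S) {z\<in>S. f z \<in> p ` D} \<and>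
                 smooth_on {z\<in>S. f z \<in> p ` D} (inv_into D p \<circ> f))"

text \<open>\<open>\<A>\<close> makes \<open>G\<close> an immersed submanifold of dimension \<open>DIM('d)\<close>: the inclusion of \<open>G\<close> is an
  injective immersion. Countability of \<open>\<A>\<close> is second countability, the last condition is
  smoothness of the transition maps, and the Hausdorff property is inherited from the space of
  jets.\<close>

definition immersed_submanifold :: "jet set \<Rightarrow> ('d::euclidean_space) atlas \<Rightarrow> bool" where
  "immersed_submanifold G \<A> \<longleftrightarrow>
     countable \<A> \<and>
     (\<Union>(D, p)\<in>\<A>. p ` D) = G \<and>
     (\<forall>(D, p)\<in>\<A>. open D \<and> inj_on p D \<and> smooth_on D p \<and>
                 (\<forall>u\<in>D. inj (frechet_derivative p (at u)))) \<and>
     (\<forall>(D, p)\<in>\<A>. smooth_into \<A> D p)"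

definition wide_subgroupoid :: "(real^3) set \<Rightarrow> jet set \<Rightarrow> bool" where
  "wide_subgroupoid \<B> G \<longleftrightarrow>
     G \<subseteq> Pi1 \<B> \<B> \<and>
     (\<forall>x\<in>\<B>. ident x \<in> G) \<and>
     (\<forall>j\<in>G. jet_inv j \<in> G) \<and>
     (\<forall>j\<in>G. \<forall>k\<in>G. source j = target k \<longrightarrow> jet_comp j k \<in> G)"

text \<open>\<open>G\<close> with the smooth structure \<open>\<A>\<close> is a Lie groupoid over \<open>\<B>\<close> and an immersed submanifold of
  the jet groupoid. The domain of the multiplication is, in parameters, the submanifold of
  composable pairs. Embedded Lie subgroupoids are a special case.\<close>

definition lie_subgroupoid ::
  "(real^3) set \<Rightarrow> jet set \<Rightarrow> ('d::euclidean_space) atlas \<Rightarrow> bool" where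
  "lie_subgroupoid \<B> G \<A> \<longleftrightarrow>
     wide_subgroupoid \<B> G \<and>
     immersed_submanifold G \<A> \<and>
     (\<forall>(D, p)\<in>\<A>. \<forall>u\<in>D. surj (frechet_derivative (source \<circ> p) (at u)) \<and>
                        surj (frechet_derivative (target \<circ> p) (at u))) \<and>
     smooth_into \<A> \<B> ident \<and>
     (\<forall>(D, p)\<in>\<A>. smooth_into \<A> D (jet_inv \<circ> p)) \<and>
     (\<forall>(D, p)\<in>\<A>. \<forall>(E, q)\<in>\<A>.
        smooth_into \<A> {(u, v). u \<in> D \<and> v \<in> E \<and> source (p u) = target (q v)}
          (\<lambda>(u, v). jet_comp (p u) (q v)))"

text \<open>The tangent space at \<open>g\<close> of the immersed submanifold with atlas \<open>\<A>\<close>, as a subspace of the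
  ambient tangent space.\<close>

definition tangent_space :: "('d::euclidean_space) atlas \<Rightarrow> jet \<Rightarrow> jet set" where
  "tangent_space \<A> g = (\<Union>(D, p)\<in>\<A>. \<Union>u\<in>{u\<in>D. p u = g}. range (frechet_derivative p (at u)))"

text \<open>The total space of the Lie algebroid over \<open>\<B>\<close>, with fibre \<open>ker T\<^bsub>\<epsilon>(x)\<^esub>\<beta>\<close> over \<open>x\<close>.\<close>

definition lie_algebroid ::
  "(real^3) set \<Rightarrow> ('d::euclidean_space) atlas \<Rightarrow> ((real^3) \<times> jet) set" where
  "lie_algebroid \<B> \<A> =
     (SIGMA x:\<B>. {\<xi> \<in> tangent_space \<A> (ident x). frechet_derivative target (at (ident x)) \<xi> = 0})"


section \<open>Induced coordinates\<close>

definition local_coordinates :: "(real^3) set \<Rightarrow> (real^3 \<Rightarrow> real^3) \<Rightarrow> bool" where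
  "local_coordinates U c \<longleftrightarrow> diffeo_on U c"

text \<open>The coordinates \<open>(x\<^sup>i, y\<^sup>j, y\<^sup>j\<^sub>i)\<close> induced on \<open>Pi1 U U\<close> by coordinates \<open>c\<close> on \<open>U\<close>. For a jet of
  \<open>\<psi>\<close> the matrix \<open>(y\<^sup>j\<^sub>i)\<close> is the Jacobian matrix of \<open>c \<circ> \<psi> \<circ> c\<inverse>\<close>.\<close>

fun induced_coordinates :: "(real^3 \<Rightarrow> real^3) \<Rightarrow> jet \<Rightarrow> jet" where
  "induced_coordinates c (X, Y, A) = (c X, c Y, jacobi c Y ** A ** matrix_inv (jacobi c X))"

text \<open>\<open>algebroid_vector c X v M\<close> is the tangent vector
  \<open>v\<^sup>i \<partial>/\<partial>x\<^sup>i + M\<^sup>j\<^sub>i \<partial>/\<partial>y\<^sup>j\<^sub>i\<close> at \<open>\<epsilon>(X)\<close>, which the coordinates induced by \<open>c\<close> map to \<open>(v, 0, M)\<close>.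
  It is unique since \<open>induced_coordinates c\<close> is a diffeomorphism near \<open>\<epsilon>(X)\<close>.\<close>

definition algebroid_vector :: "(real^3 \<Rightarrow> real^3) \<Rightarrow> real^3 \<Rightarrow> real^3 \<Rightarrow> real^3^3 \<Rightarrow> jet" where
  "algebroid_vector c X v M =
     (THE \<xi>. frechet_derivative (induced_coordinates c) (at (ident X)) \<xi> = (v, 0, M))"

text \<open>The section \<open>\<Delta>\<close> on \<open>TU\<close>; the tangent vector \<open>w\<close> at \<open>X\<close> has components
  \<open>v\<^sup>i = dx\<^sup>i(w)\<close> in the coordinates \<open>c\<close>.\<close>

definition Delta :: "(real^3 \<Rightarrow> real^3) \<Rightarrow> (real^3) \<times> (real^3) \<Rightarrow> (real^3) \<times> jet" where
  "Delta c = (\<lambda>(X, w). (X, algebroid_vector c X (frechet_derivative c (at X) w) 0))"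

end

theory Submission
  imports Defs
begin

text \<open>In standard coordinates, \<open>(X, Y, A)\<close> is a material isomorphism iff
  \<open>W (X, X, F A) = W (Y, Y, F)\<close> for all invertible \<open>F\<close>, and with \<open>J\<close> the Jacobian matrix of the
  coordinates \<open>c\<close>, \<open>\<Delta>\<close> sends \<open>w\<close> at \<open>X\<close> to \<open>(w, 0, J(X)\<inverse> DJ(X)w)\<close>. Homogeneity with respect to \<open>c\<close>
  says that all the jets \<open>\<phi>(X, Y) = (X, Y, J(Y)\<inverse> J(X))\<close> are material isomorphisms.

  If \<open>\<Delta>\<close> takes values in the material algebroid, then differentiating the above equation along
  the material groupoid shows that \<open>X \<mapsto> W (X, X, F J(X))\<close> has derivative zero, hence is constant
  on balls; this is homogeneity of the balls with respect to \<open>c\<close>.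

  Conversely, \<open>\<Delta>(w)\<close> at \<open>Y\<close> is the derivative at \<open>X = Y\<close> of \<open>X \<mapsto> \<phi>(X, Y)\<close>, but the material
  groupoid is only an immersed submanifold, so that this map need not obviously be continuous into
  it. Since its atlas is countable, Baire's theorem makes \<open>X \<mapsto> \<phi>(X, Y)\<close> continuous into it near
  some \<open>X\<^sub>1\<close> in any given open set. Left translation by \<open>\<phi>(Y, X\<^sub>1)\<close> gives tangency at the identity
  over \<open>X\<^sub>1\<close>, and as such points are dense, continuity of the tangent spaces along the identities
  gives tangency everywhere.\<close>

section \<open>Smooth maps\<close>

lemma smooth_on_imp_continuous_on:
  assumes "smooth_on S f"
  shows "continuous_on S f"
  unfolding continuous_on_eq_continuous_within
proof
  fix x assume x: "x \<in> S"
  then obtain N g where g: "open N" "x \<in> N" "\<And>k. Ck_on k N g" "\<And>y. y \<in> S \<inter> N \<Longrightarrow> g y = f y"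
    using assms unfolding smooth_on_def by metis
  have "continuous_on N g"
    using g(3)[of 0] by simp
  then have "continuous_on (S \<inter> N) f"
    using g(4) by (metis continuous_on_cong continuous_on_subset inf_le2)
  then have "continuous (at x within S \<inter> N) f"
    using x g(2) by (simp add: continuous_on_eq_continuous_within)
  then show "continuous (at x within S) f"
    using at_within_nhd[OF g(2,1), of S "S \<inter> N"] by (simp add: Int_assoc)
qed

lemma smooth_on_imp_differentiable:
  assumes "open S" "smooth_on S f" "x \<in> S"
  shows "f differentiable (at x)"
proof -
  obtain N g where g: "open N" "x \<in> N" "\<And>k. Ck_on k N g" "\<And>y. y \<in> S \<inter> N \<Longrightarrow> g y = f y"
    using assms unfolding smooth_on_def by metis
  obtain g' where "(g has_derivative g') (at x)"
    using g(3)[of "Suc 0"] g(2) by (auto simp: differentiable_def)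
  then have "(f has_derivative g') (at x)"
    by (rule has_derivative_transform_within_open[where s="S \<inter> N"]) (use g assms in auto)
  then show ?thesis
    by (auto simp: differentiable_def)
qed

lemma smooth_on_imp_has_derivative:
  assumes "open S" "smooth_on S f" "x \<in> S"
  shows "(f has_derivative frechet_derivative f (at x)) (at x)"
  using smooth_on_imp_differentiable[OF assms] frechet_derivative_works by blast

text \<open>Since \<open>S\<close> is open, a local extension \<open>g\<close> has the same
  derivative as \<open>f\<close> at every point of \<open>S\<close> near \<open>x\<close>; and the
  condition \<open>Ck_on (Suc k)\<close> on \<open>g\<close> contains \<open>Ck_on k\<close> for its
  directional derivatives.\<close>

lemma smooth_on_frechet_derivative:
  assumes "open S" "smooth_on S f"
  shows "smooth_on S (\<lambda>x. frechet_derivative f (at x) v)"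
  unfolding smooth_on_def
proof
  fix x assume x: "x \<in> S"
  then obtain N g where g: "open N" "x \<in> N" "\<And>k. Ck_on k N g" "\<And>y. y \<in> S \<inter> N \<Longrightarrow> g y = f y"
    using assms unfolding smooth_on_def by metis
  have "frechet_derivative g (at y) = frechet_derivative f (at y)" if y: "y \<in> S \<inter> N" for y
  proof -
    have "(f has_derivative frechet_derivative f (at y)) (at y)"
      using smooth_on_imp_has_derivative assms y by blast
    then have "(g has_derivative frechet_derivative f (at y)) (at y)"
      by (rule has_derivative_transform_within_open[where s="S \<inter> N"]) (use g assms y in auto)
    then show ?thesis
      by (metis frechet_derivative_at)
  qed
  moreover have "Ck_on k N (\<lambda>x. frechet_derivative g (at x) v)" for k
    using g(3)[of "Suc k"] by simp
  ultimately show "\<exists>N g. open N \<and> x \<in> N \<and> (\<forall>k. Ck_on k N g) \<and>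
      (\<forall>y\<in>S \<inter> N. g y = frechet_derivative f (at y) v)"
    using g(1,2) by (intro exI[of _ N] exI[of _ "\<lambda>x. frechet_derivative g (at x) v"]) auto
qed

lemma smooth_on_subset:
  assumes "smooth_on S f" "T \<subseteq> S"
  shows "smooth_on T f"
  unfolding smooth_on_def
proof
  fix x assume "x \<in> T"
  then obtain N g where "open N" "x \<in> N" "\<forall>k. Ck_on k N g" "\<forall>y\<in>S \<inter> N. g y = f y"
    using assms unfolding smooth_on_def by (meson subsetD)
  then show "\<exists>N g. open N \<and> x \<in> N \<and> (\<forall>k. Ck_on k N g) \<and> (\<forall>y\<in>T \<inter> N. g y = f y)"
    using assms(2) by (intro exI[of _ N] exI[of _ g]) auto
qed

lemma smooth_on_cong: "smooth_on S f \<Longrightarrow> (\<And>x. x \<in> S \<Longrightarrow> f x = g x) \<Longrightarrow> smooth_on S g"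
  unfolding smooth_on_def by (metis Int_iff)

lemma Ck_on_const: "Ck_on k S (\<lambda>x. c)"
  by (induction k arbitrary: c) (auto simp: frechet_derivative_const)

lemma smooth_on_affine:
  assumes "bounded_linear L"
  shows "smooth_on S (\<lambda>x. L x + b)"
proof -
  have d: "((\<lambda>x. L x + b) has_derivative L) (at x)" for x
    by (rule has_derivative_eq_rhs,
        rule has_derivative_add[OF bounded_linear_imp_has_derivative[OF assms] has_derivative_const]) simp
  have "frechet_derivative (\<lambda>x. L x + b) (at x) = L" for x
    using frechet_derivative_at[OF d] by simp
  then have "Ck_on k UNIV (\<lambda>x. L x + b)" for k
    using d by (cases k)
      (auto simp: Ck_on_const differentiable_def intro: has_derivative_continuous
        intro!: continuous_at_imp_continuous_on)
  then show ?thesis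
    unfolding smooth_on_def by blast
qed

text \<open>The image of \<open>V\<close> is open because it is the preimage of \<open>V\<close>
  under the continuous inverse of \<open>c\<close>.\<close>

lemma diffeo_on_subset:
  assumes "diffeo_on U c" "open V" "V \<subseteq> U"
  shows "diffeo_on V c"
proof -
  let ?g = "inv_into U c"
  have inj: "inj_on c U" and sm: "smooth_on U c" and op: "open (c ` U)" and smi: "smooth_on (c ` U) ?g"
    using assms(1) by (auto simp: diffeo_on_def)
  have "c ` V = {y \<in> c ` U. ?g y \<in> V}"
    using assms(3) inj by (auto simp: subset_eq)
  then have "open (c ` V)"
    using continuous_open_preimage[OF smooth_on_imp_continuous_on[OF smi] op assms(2)]
    by (simp add: Collect_conj_eq vimage_def)
  moreover have "smooth_on (c ` V) (inv_into V c)"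
  proof (rule smooth_on_cong)
    show "smooth_on (c ` V) ?g"
      by (rule smooth_on_subset[OF smi]) (use assms(3) in auto)
    show "\<And>x. x \<in> c ` V \<Longrightarrow> ?g x = inv_into V c x"
      using assms(3) inj by (auto simp: inj_on_subset subset_eq)
  qed
  ultimately show ?thesis
    using assms(2) inj_on_subset[OF inj assms(3)] smooth_on_subset[OF sm assms(3)]
    by (simp add: diffeo_on_def)
qed

section \<open>Matrices and Jacobians\<close>

lemma matrix_inv_unique:
  fixes A :: "real^'n^'n"
  assumes "B ** A = mat 1"
  shows "matrix_inv A = B"
proof -
  have AB: "A ** B = mat 1"
    using assms matrix_left_right_inverse by blast
  then have "A ** matrix_inv A = mat 1 \<and> matrix_inv A ** A = mat 1"
    unfolding matrix_inv_def by (rule_tac someI) (use assms in blast)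
  then show ?thesis
    by (metis assms matrix_mul_assoc matrix_mul_lid matrix_mul_rid)
qed

lemma matrix_inv_mult:
  fixes A :: "real^'n^'n"
  assumes "invertible A"
  shows "matrix_inv A ** A = mat 1" "A ** matrix_inv A = mat 1"
proof -
  obtain B where "A ** B = mat 1" "B ** A = mat 1"
    using assms unfolding invertible_def by blast
  with matrix_inv_unique[of B A] show "matrix_inv A ** A = mat 1" "A ** matrix_inv A = mat 1"
    by simp_all
qed

lemma invertible_matrix_inv:
  fixes A :: "real^'n^'n"
  shows "invertible A \<Longrightarrow> invertible (matrix_inv A)"
  using matrix_inv_mult[of A] unfolding invertible_def by blast

lemma bounded_bilinear_matrix_mult:
  "bounded_bilinear ((**) :: real^'n^'m \<Rightarrow> real^'k^'n \<Rightarrow> real^'k^'m)"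
proof -
  have "linear (\<lambda>B :: real^'k^'n. A ** B)" for A :: "real^'n^'m"
    by (rule linearI) (simp_all add: vec_eq_iff matrix_matrix_mult_def sum.distrib sum_distrib_left
        distrib_left mult.left_commute)
  moreover have "linear (\<lambda>A :: real^'n^'m. A ** B)" for B :: "real^'k^'n"
    by (rule linearI) (simp_all add: vec_eq_iff matrix_matrix_mult_def sum.distrib sum_distrib_left
        distrib_right mult.assoc)
  ultimately show ?thesis
    by (simp add: bilinear_conv_bounded_bilinear[symmetric] bilinear_def)
qed

lemmas has_derivative_matrix_mult = bounded_bilinear.FDERIV[OF bounded_bilinear_matrix_mult]
lemmas matrix_add_left = bounded_bilinear.add_left[OF bounded_bilinear_matrix_mult]
lemmas matrix_diff_left = bounded_bilinear.diff_left[OF bounded_bilinear_matrix_mult]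
lemmas matrix_zero_left = bounded_bilinear.zero_left[OF bounded_bilinear_matrix_mult]
lemmas bounded_linear_matrix_mult_right =
  bounded_bilinear.bounded_linear_right[OF bounded_bilinear_matrix_mult]

text \<open>Affine maps serve as test maps: they realise every jet with invertible matrix part, and
  they give deformations with any prescribed invertible Jacobian.\<close>

lemma diffeo_on_affine:
  fixes F :: "real^'n^'n"
  assumes "invertible F" "open S"
  shows "diffeo_on S (\<lambda>x. F *v x + b)"
proof -
  let ?a = "\<lambda>x. F *v x + b"
  let ?b = "\<lambda>y. matrix_inv F *v y + - (matrix_inv F *v b)"
  have ba: "?b (?a x) = x" for x
    using matrix_inv_mult[OF assms(1)] by (simp add: matrix_vector_right_distrib matrix_vector_mul_assoc)
  have ab: "?a (?b x) = x" for x
    using matrix_inv_mult[OF assms(1)] by (simp add: matrix_vector_right_distrib matrix_vector_mul_assoc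
       matrix_vector_mult_diff_distrib)
  have inj: "inj_on ?a S"
    by (metis (lifting) ba inj_onI)
  have "?a ` S = ?b -` S"
    using ab ba by (auto simp: image_iff simp del: add_uminus_conv_diff) (metis ab)
  moreover have "open (?b -` S)"
    by (intro open_vimage assms continuous_intros)
  moreover have "smooth_on (?a ` S) (inv_into S ?a)"
    by (rule smooth_on_cong[of _ ?b, OF smooth_on_affine[OF matrix_vector_mul_bounded_linear]])
       (auto simp only: ba inv_into_f_f[OF inj])
  ultimately show ?thesis
    using assms(2) inj smooth_on_affine[OF matrix_vector_mul_bounded_linear]
    by (simp add: diffeo_on_def)
qed

section \<open>Jacobian matrices and their derivatives\<close>

lemma jacobi_eqI:
  assumes "(f has_derivative (\<lambda>h. A *v h)) (at x)"
  shows "jacobi f x = A"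
  using frechet_derivative_at[OF assms] by (metis jacobi_def matrix_of_matrix_vector_mul)

lemma has_derivative_jacobi:
  assumes "f differentiable (at x)"
  shows "(f has_derivative (\<lambda>h. jacobi f x *v h)) (at x)"
proof -
  have "(f has_derivative frechet_derivative f (at x)) (at x)"
    using assms frechet_derivative_works by blast
  moreover from this have "linear (frechet_derivative f (at x))"
    by (rule has_derivative_linear)
  ultimately show ?thesis
    by (simp add: jacobi_def matrix_works eta_contract_eq)
qed

lemma jacobi_comp:
  assumes "f differentiable (at x)" "g differentiable (at (f x))"
  shows "jacobi (g \<circ> f) x = jacobi g (f x) ** jacobi f x"
  using diff_chain_at[OF has_derivative_jacobi[OF assms(1)] has_derivative_jacobi[OF assms(2)]]
  by (intro jacobi_eqI) (simp add: o_def matrix_vector_mul_assoc)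

text \<open>For smooth \<open>f\<close> this is the derivative of \<open>jacobi f\<close> at
  \<open>x\<close> in direction \<open>w\<close>. The entrywise form through iterated directional
  derivatives reduces its continuity in \<open>x\<close> to
  \<open>smooth_on_frechet_derivative\<close>.\<close>

definition djacobi :: "(real^3 \<Rightarrow> real^3) \<Rightarrow> real^3 \<Rightarrow> real^3 \<Rightarrow> real^3^3" where
  "djacobi f x w =
     (\<chi> i j. frechet_derivative (\<lambda>y. frechet_derivative f (at y) (axis j 1)) (at x) w $ i)"

lemma jacobi_has_derivative:
  assumes "open S" "smooth_on S f" "x \<in> S"
  shows "(jacobi f has_derivative djacobi f x) (at x)"
proof -
  let ?g = "\<lambda>j y. frechet_derivative f (at y) (axis j 1)"
  have "(?g j has_derivative frechet_derivative (?g j) (at x)) (at x)" for j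
    using assms smooth_on_frechet_derivative smooth_on_imp_has_derivative by blast
  then have d: "((\<lambda>y. ?g j y $ i) has_derivative (\<lambda>w. frechet_derivative (?g j) (at x) w $ i)) (at x)"
    for i j
    by (rule bounded_linear.has_derivative[OF bounded_linear_vec_nth])
  show ?thesis
    unfolding has_derivative_componentwise_within[where f="jacobi f"]
  proof
    fix b :: "real^3^3" assume "b \<in> Basis"
    then obtain i j where "b = axis i (axis j 1)"
      by (auto simp: Basis_vec_def)
    then show "((\<lambda>y. jacobi f y \<bullet> b) has_derivative (\<lambda>w. djacobi f x w \<bullet> b)) (at x)"
      using d[of j i] by (simp add: inner_axis jacobi_def djacobi_def matrix_def)
  qed
qed

lemma continuous_on_djacobi:
  assumes "open S" "smooth_on S f"
  shows "continuous_on S (\<lambda>x. djacobi f x w)"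
  unfolding djacobi_def
  using assms by (intro continuous_on_vec_lambda continuous_on_component smooth_on_imp_continuous_on
      smooth_on_frechet_derivative)

lemma smooth_on_imp_continuous_on_jacobi:
  assumes "open S" "smooth_on S f"
  shows "continuous_on S (jacobi f)"
  using jacobi_has_derivative[OF assms] assms(1)
  by (metis continuous_at_imp_continuous_on has_derivative_continuous)

lemma diffeo_on_imp_differentiable:
  "diffeo_on U c \<Longrightarrow> x \<in> U \<Longrightarrow> c differentiable (at x)"
  using smooth_on_imp_differentiable by (auto simp: diffeo_on_def)

lemma diffeo_on_imp_inv_into_differentiable:
  "diffeo_on U c \<Longrightarrow> x \<in> U \<Longrightarrow> inv_into U c differentiable (at (c x))"
  using smooth_on_imp_differentiable[of "c ` U"] by (auto simp: diffeo_on_def)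

lemma jacobi_inv_into_mult:
  assumes "diffeo_on U c" "x \<in> U"
  shows "jacobi (inv_into U c) (c x) ** jacobi c x = mat 1"
proof -
  have "((\<lambda>y. y) has_derivative (\<lambda>h. mat 1 *v h)) (at x)"
    by (simp add: has_derivative_ident)
  then have "((inv_into U c \<circ> c) has_derivative (\<lambda>h. mat 1 *v h)) (at x)"
    by (rule has_derivative_transform_within_open[where s=U])
       (use assms in \<open>auto simp: diffeo_on_def\<close>)
  then have "jacobi (inv_into U c \<circ> c) x = mat 1"
    by (rule jacobi_eqI)
  then show ?thesis
    using jacobi_comp diffeo_on_imp_differentiable diffeo_on_imp_inv_into_differentiable assms
    by metis
qed

lemma matrix_inv_jacobi:
  assumes "diffeo_on U c" "x \<in> U"
  shows "matrix_inv (jacobi c x) = jacobi (inv_into U c) (c x)"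
  using jacobi_inv_into_mult[OF assms] by (rule matrix_inv_unique)

lemma invertible_jacobi:
  assumes "diffeo_on U c" "x \<in> U"
  shows "invertible (jacobi c x)"
  using jacobi_inv_into_mult[OF assms] invertible_left_inverse by blast

text \<open>The derivative of matrix inversion is avoided: the inverse matrix is the Jacobian of the
  inverse map at \<open>c y\<close>, so the chain rule applies.\<close>

lemma matrix_inv_jacobi_differentiable:
  assumes "diffeo_on U c" "x \<in> U"
  shows "(\<lambda>y. matrix_inv (jacobi c y)) differentiable (at x)"
proof -
  let ?g = "inv_into U c"
  have "(jacobi ?g has_derivative djacobi ?g (c x)) (at (c x))"
    using assms by (intro jacobi_has_derivative[of "c ` U"]) (auto simp: diffeo_on_def)
  moreover obtain c' where "(c has_derivative c') (at x)"
    using diffeo_on_imp_differentiable[OF assms] by (auto simp: differentiable_def)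
  ultimately have "((\<lambda>y. jacobi ?g (c y)) has_derivative (\<lambda>h. djacobi ?g (c x) (c' h))) (at x)"
    using diff_chain_at by (fastforce simp: o_def)
  then have "((\<lambda>y. matrix_inv (jacobi c y)) has_derivative (\<lambda>h. djacobi ?g (c x) (c' h))) (at x)"
    by (rule has_derivative_transform_within_open[where s=U])
       (use assms matrix_inv_jacobi in \<open>auto simp: diffeo_on_def\<close>)
  then show ?thesis
    by (auto simp: differentiable_def)
qed

lemma jacobi_affine: "jacobi (\<lambda>x. F *v x + b) x = F"
  by (rule jacobi_eqI) (auto intro!: derivative_eq_intros bounded_linear_imp_has_derivative)

section \<open>The material groupoid and the induced coordinates\<close>

lemma Pi1_iff:
  assumes "open M" "open N"
  shows "(X, Y, A) \<in> Pi1 M N \<longleftrightarrow> X \<in> M \<and> Y \<in> N \<and> invertible A"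
proof
  assume "(X, Y, A) \<in> Pi1 M N"
  then show "X \<in> M \<and> Y \<in> N \<and> invertible A"
    using invertible_jacobi by (auto simp: Pi1_def jet1_def)
next
  assume XY: "X \<in> M \<and> Y \<in> N \<and> invertible A"
  \<comment> \<open>The affine map with linear part \<open>A\<close> that sends \<open>X\<close> to
    \<open>Y\<close> realises the jet; cutting its domain down to \<open>U\<close> keeps source and
    image inside \<open>M\<close> and \<open>N\<close>.\<close>
  define a where "a x = A *v x + (Y - A *v X)" for x
  define U where "U = M \<inter> a -` N"
  have "open U"
    unfolding U_def a_def by (intro open_Int assms open_vimage continuous_intros)
  then have "diffeo_on U a"
    unfolding a_def using XY by (intro diffeo_on_affine) auto
  moreover have "X \<in> U"
    using XY by (simp add: U_def a_def)
  moreover have "jet1 a X = (X, Y, A)"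
    unfolding jet1_def a_def jacobi_affine by simp
  ultimately show "(X, Y, A) \<in> Pi1 M N"
    unfolding Pi1_def U_def
    by (smt (verit, ccfv_threshold) CollectI image_subset_iff inf.cobounded1 inf.cobounded2 vimageE IntD2)
qed

text \<open>\<open>extend\<close> forgets the target, so a deformation enters only through its
  Jacobian at \<open>Y\<close>. Linear maps show that every invertible \<open>F\<close> occurs, and
  \<open>invertible_jacobi\<close> that nothing else does. In this form \<open>U\<close> only
  restricts the positions of \<open>X\<close> and \<open>Y\<close>, which allows passing between
  \<open>U\<close> and a larger body.\<close>

lemma material_groupoid_iff:
  assumes "open U"
  shows "(X, Y, A) \<in> material_groupoid U W \<longleftrightarrow>
    X \<in> U \<and> Y \<in> U \<and> invertible A \<and> (\<forall>F. invertible F \<longrightarrow> W (X, X, F ** A) = W (Y, Y, F))"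
    (is "_ \<longleftrightarrow> ?R")
proof
  assume "(X, Y, A) \<in> material_groupoid U W"
  then have P: "X \<in> U" "Y \<in> U" "invertible A"
    and W: "deformation U \<kappa> \<Longrightarrow>
      extend W (jet_comp (jet1 \<kappa> Y) (X, Y, A)) = extend W (jet1 \<kappa> Y)" for \<kappa>
    using assms by (auto simp: material_groupoid_def material_isomorphism_def Pi1_iff)
  have "W (X, X, F ** A) = W (Y, Y, F)" if "invertible F" for F
    using W[of "\<lambda>x. F *v x + 0"] diffeo_on_affine[OF that assms, of 0]
    by (simp only: deformation_def jet1_def jacobi_affine jet_comp.simps extend.simps)
  with P show ?R by blast
next
  assume ?R
  then show "(X, Y, A) \<in> material_groupoid U W"
    using assms by (auto simp: material_groupoid_def material_isomorphism_def Pi1_iff jet1_def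
        deformation_def invertible_jacobi)
qed

text \<open>By the chain rule: the translation has the identity as derivative and takes
  \<open>\<kappa> X\<close> to \<open>\<kappa> Y\<close>, where the inverse of
  \<open>\<kappa>\<close> has Jacobian \<open>matrix_inv (jacobi \<kappa> Y)\<close>.\<close>

lemma homogeneous_iff:
  assumes "open U"
  shows "homogeneous U W \<longleftrightarrow>
    (\<exists>\<kappa>. diffeo_on U \<kappa> \<and>
       (\<forall>X\<in>U. \<forall>Y\<in>U. (X, Y, matrix_inv (jacobi \<kappa> Y) ** jacobi \<kappa> X) \<in> material_groupoid U W))"
proof -
  have "jet1 (inv_into U \<kappa> \<circ> translation (\<kappa> Y - \<kappa> X) \<circ> \<kappa>) X =
      (X, Y, matrix_inv (jacobi \<kappa> Y) ** jacobi \<kappa> X)" (is "jet1 (?g \<circ> ?t \<circ> \<kappa>) X = _")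
    if \<kappa>: "diffeo_on U \<kappa>" and XY: "X \<in> U" "Y \<in> U" for \<kappa> X Y
  proof -
    have t: "?t (\<kappa> X) = \<kappa> Y"
      by (simp add: translation_def)
    have dt: "(?t has_derivative (\<lambda>h. mat 1 *v h)) (at (\<kappa> X))"
      unfolding translation_def by (auto intro!: derivative_eq_intros)
    have d: "(?t \<circ> \<kappa>) differentiable (at X)" 
      using diff_chain_at[OF has_derivative_jacobi[OF diffeo_on_imp_differentiable[OF \<kappa> XY(1)]] dt]
      by (auto simp: differentiable_def)
    have "jacobi (?t \<circ> \<kappa>) X = jacobi \<kappa> X"
      using jacobi_comp[OF diffeo_on_imp_differentiable[OF \<kappa> XY(1)], of ?t] dt jacobi_eqI[OF dt]
      by (auto simp: differentiable_def)
    then have "jacobi (?g \<circ> (?t \<circ> \<kappa>)) X = matrix_inv (jacobi \<kappa> Y) ** jacobi \<kappa> X"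
      using jacobi_comp[OF d, of ?g] diffeo_on_imp_inv_into_differentiable[OF \<kappa> XY(2)] 
        matrix_inv_jacobi[OF \<kappa> XY(2)] by (simp add: t)
    moreover have "?g (\<kappa> Y) = Y"
      using \<kappa> XY by (simp add: diffeo_on_def)
    ultimately show ?thesis
      by (simp add: jet1_def o_assoc t)
  qed
  then show ?thesis
    unfolding homogeneous_def deformation_def by (metis (no_types, lifting))
qed

section \<open>Induced coordinates and the section \<open>Delta\<close>\<close>

lemma ident_eq: "ident x = (x, x, mat 1)"
proof -
  have "(id has_derivative (\<lambda>h. mat 1 *v h)) (at x)"
    by (simp add: id_def)
  then show ?thesis
    by (simp add: ident_def jet1_def jacobi_eqI)
qed

lemma induced_coordinates_has_derivative:
  assumes c: "diffeo_on U c" and X: "X \<in> U"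
  shows "(induced_coordinates c has_derivative (\<lambda>(h, k, M).
    (jacobi c X *v h, jacobi c X *v k,
     (djacobi c X k + jacobi c X ** M - djacobi c X h) ** matrix_inv (jacobi c X)))) (at (ident X))"
proof -
  let ?J = "jacobi c" and ?K = "\<lambda>y. matrix_inv (jacobi c y)"
  have U: "open U"
    using c by (simp add: diffeo_on_def)
  obtain K' where K': "(?K has_derivative K') (at X)"
    using matrix_inv_jacobi_differentiable[OF c X] by (auto simp: differentiable_def)
  have J': "(?J has_derivative djacobi c X) (at X)"
    using c X by (intro jacobi_has_derivative[of U]) (auto simp: diffeo_on_def)
  have c': "(c has_derivative (\<lambda>h. ?J X *v h)) (at X)"
    by (rule has_derivative_jacobi[OF diffeo_on_imp_differentiable[OF c X]])
  \<comment> \<open>Only the product of \<open>?J X\<close> with the unknown derivative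
    \<open>K'\<close> is needed; differentiating the constant product \<open>?J y ** ?K y\<close>
    determines it.\<close>
  have "((\<lambda>y. ?J y ** ?K y) has_derivative (\<lambda>h. ?J X ** K' h + djacobi c X h ** ?K X)) (at X)"
    by (rule has_derivative_matrix_mult[OF J' K'])
  then have "((\<lambda>y. mat 1) has_derivative (\<lambda>h. ?J X ** K' h + djacobi c X h ** ?K X)) (at X)"
    by (rule has_derivative_transform_within_open[OF _ U X])
       (simp add: matrix_inv_mult(2)[OF invertible_jacobi[OF c]])
  then have "(\<lambda>h. ?J X ** K' h + djacobi c X h ** ?K X) = (\<lambda>h. 0)"
    by (rule has_derivative_unique) (rule has_derivative_const)
  then have JK': "?J X ** K' h = - (djacobi c X h ** ?K X)" for h
    by (simp add: fun_eq_iff eq_neg_iff_add_eq_0)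
  define H where "H z = (c (fst z), c (fst (snd z)), ?J (fst (snd z)) ** snd (snd z) ** ?K (fst z))"
    for z :: jet
  have "induced_coordinates c = H"
    by (auto simp: H_def)
  moreover have "(H has_derivative (\<lambda>z. (?J X *v fst z, ?J X *v fst (snd z),
      ?J X ** mat 1 ** K' (fst z) + (?J X ** snd (snd z) + djacobi c X (fst (snd z)) ** mat 1) ** ?K X)))
      (at (X, X, mat 1))"
  proof -
    have X: "((\<lambda>z::jet. fst z) has_derivative (\<lambda>z. fst z)) (at (X, X, mat 1))"
      and Y: "((\<lambda>z::jet. fst (snd z)) has_derivative (\<lambda>z. fst (snd z))) (at (X, X, mat 1))"
      and A: "((\<lambda>z::jet. snd (snd z)) has_derivative (\<lambda>z. snd (snd z))) (at (X, X, mat 1))"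
      by (intro derivative_intros)+
    have 1: "((\<lambda>z::jet. c (fst z)) has_derivative (\<lambda>z. ?J X *v fst z)) (at (X, X, mat 1))"
      by (rule has_derivative_compose[OF X]) (simp add: c')
    have 2: "((\<lambda>z::jet. c (fst (snd z))) has_derivative (\<lambda>z. ?J X *v fst (snd z))) (at (X, X, mat 1))"
      by (rule has_derivative_compose[OF Y]) (simp add: c')
    have 3: "((\<lambda>z::jet. ?J (fst (snd z))) has_derivative (\<lambda>z. djacobi c X (fst (snd z)))) (at (X, X, mat 1))"
      by (rule has_derivative_compose[OF Y]) (simp add: J')
    have 4: "((\<lambda>z::jet. ?K (fst z)) has_derivative (\<lambda>z. K' (fst z))) (at (X, X, mat 1))"
      by (rule has_derivative_compose[OF X]) (simp add: K')
    show ?thesis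
      unfolding H_def
      using has_derivative_Pair[OF 1 has_derivative_Pair[OF 2
          has_derivative_matrix_mult[OF has_derivative_matrix_mult[OF 3 A] 4]]]
      by simp
  qed
  ultimately show ?thesis
    by (simp add: ident_eq JK' case_prod_unfold matrix_add_left matrix_diff_left algebra_simps)
qed

text \<open>The derivative of the induced coordinates turns the definition into a linear system. Its
  first two components force \<open>h = w\<close> and \<open>k = 0\<close>, and the third then
  becomes \<open>?J ** M = djacobi c X w\<close>; invertibility of \<open>?J\<close> gives the
  uniqueness demanded by \<open>THE\<close>.\<close>

lemma Delta_eq:
  assumes c: "diffeo_on U c" and X: "X \<in> U"
  shows "Delta c (X, w) = (X, (w, 0, matrix_inv (jacobi c X) ** djacobi c X w))"
proof -
  let ?J = "jacobi c X"
  let ?K = "matrix_inv ?J"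
  have KJ: "?K ** ?J = mat 1" and JK: "?J ** ?K = mat 1"
    using matrix_inv_mult[OF invertible_jacobi[OF c X]] by auto
  have lin: "linear (djacobi c X)"
    using c X by (intro has_derivative_linear[OF jacobi_has_derivative[of U]]) (auto simp: diffeo_on_def)
  have d: "frechet_derivative (induced_coordinates c) (at (ident X)) = (\<lambda>(h, k, M).
    (?J *v h, ?J *v k, (djacobi c X k + ?J ** M - djacobi c X h) ** ?K))"
    using frechet_derivative_at[OF induced_coordinates_has_derivative[OF c X]] by simp
  have cd: "frechet_derivative c (at X) w = ?J *v w"
    using frechet_derivative_at[OF has_derivative_jacobi[OF diffeo_on_imp_differentiable[OF c X]]] by metis
  have inj: "?J *v a = ?J *v b \<longleftrightarrow> a = b" for a b
    by (metis KJ matrix_vector_mul_assoc matrix_vector_mul_lid)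
  have "algebroid_vector c X (?J *v w) 0 = (w, 0, ?K ** djacobi c X w)"
    unfolding algebroid_vector_def d
  proof (rule the_equality)
    show "(case (w, 0, ?K ** djacobi c X w) of (h, k, M) \<Rightarrow>
        (?J *v h, ?J *v k, (djacobi c X k + ?J ** M - djacobi c X h) ** ?K)) = (?J *v w, 0, 0)"
      by (simp add: linear_0[OF lin] matrix_mul_assoc JK matrix_zero_left)
  next
    fix \<xi> :: jet
    assume a: "(case \<xi> of (h, k, M) \<Rightarrow>
        (?J *v h, ?J *v k, (djacobi c X k + ?J ** M - djacobi c X h) ** ?K)) = (?J *v w, 0, 0)"
    obtain h k M where \<xi>: "\<xi> = (h, k, M)"
      by (metis prod_cases3)
    have h: "h = w" and k: "k = 0"
      using a inj[of k 0] by (auto simp: \<xi> inj)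
    have "(?J ** M - djacobi c X w) ** ?K = 0"
      using a by (simp add: \<xi> h k linear_0[OF lin])
    then have "(?J ** M - djacobi c X w) ** (?K ** ?J) = 0"
      by (simp add: matrix_mul_assoc matrix_zero_left)
    then have "?K ** (?J ** M) = ?K ** djacobi c X w"
      by (simp add: KJ)
    then show "\<xi> = (w, 0, ?K ** djacobi c X w)"
      by (simp add: \<xi> h k matrix_mul_assoc KJ)
  qed
  then show ?thesis
    by (simp add: Delta_def cd)
qed

text \<open>The map \<open>target\<close> is linear, hence its own derivative, so the vanishing
  middle component already puts the vector into the kernel and only tangency remains.\<close>

lemma Delta_mem_lie_algebroid_iff:
  assumes "diffeo_on U c" "X \<in> U" "U \<subseteq> \<B>"
  shows "Delta c (X, w) \<in> lie_algebroid \<B> \<A> \<longleftrightarrow>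
    (w, 0, matrix_inv (jacobi c X) ** djacobi c X w) \<in> tangent_space \<A> (ident X)"
proof -
  have "bounded_linear (\<lambda>z :: jet. fst (snd z))"
    by (intro bounded_linear_fst_comp bounded_linear_snd)
  moreover have "target = (\<lambda>z. fst (snd z))"
    by auto
  ultimately have "(target has_derivative target) (at (ident X))"
    using bounded_linear_imp_has_derivative by metis
  then have "frechet_derivative target (at (ident X)) = target"
    by (metis frechet_derivative_at)
  then show ?thesis
    using assms by (auto simp: Delta_eq lie_algebroid_def)
qed

section \<open>From the algebroid to homogeneity\<close>

text \<open>Along a chart of the material groupoid the two sides of the material equation agree.
  Differentiating both at the identity gives \<open>W' (w, w, F ** M)\<close> on the source side,
  and zero on the target side because the target component of the tangent vector is zero.\<close>

lemma response_constant_on_tangent: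
  fixes W :: "jet \<Rightarrow> 'v::real_normed_vector"
  assumes op: "open \<B>" and W': "(W has_derivative W') (at (X, X, F) within Pi1 \<B> \<B>)"
    and F: "invertible F"
    and \<A>: "immersed_submanifold (material_groupoid \<B> W) \<A>"
    and \<xi>: "(w, 0, M) \<in> tangent_space \<A> (ident X)"
  shows "W' (w, w, F ** M) = 0"
proof -
  obtain D p u z where Dp: "(D, p) \<in> \<A>" and u: "u \<in> D" "p u = ident X"
    and z: "frechet_derivative p (at u) z = (w, 0, M)"
    using \<xi> unfolding tangent_space_def by fastforce
  define p' where "p' = frechet_derivative p (at u)"
  have D: "open D" "smooth_on D p" "p ` D \<subseteq> material_groupoid \<B> W"
    using \<A> Dp unfolding immersed_submanifold_def by fast+
  have p': "(p has_derivative p') (at u within D)"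
    unfolding p'_def using smooth_on_imp_has_derivative[OF D(1,2) u(1)] has_derivative_at_withinI by blast
  \<comment> \<open>The two sides of the material equation for the fixed \<open>F\<close>. Both take
    the value \<open>(X, X, F)\<close> at \<open>u\<close>, so the same \<open>W'\<close> serves for
    both.\<close>
  define \<Phi> where "\<Phi> v = (fst (p v), fst (p v), F ** snd (snd (p v)))" for v
  define \<Psi> where "\<Psi> v = (fst (snd (p v)), fst (snd (p v)), F)" for v
  have G: "\<Phi> v \<in> Pi1 \<B> \<B> \<and> \<Psi> v \<in> Pi1 \<B> \<B> \<and> W (\<Phi> v) = W (\<Psi> v)" if "v \<in> D" for v
  proof -
    obtain X Y A where "p v = (X, Y, A)"
      by (metis prod_cases3)
    moreover from this have "(X, Y, A) \<in> material_groupoid \<B> W"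
      using D(3) that by force
    ultimately show ?thesis
      using F op by (simp add: \<Phi>_def \<Psi>_def Pi1_iff invertible_mult material_groupoid_iff)
  qed
  have "(\<Phi> has_derivative (\<lambda>z. (fst (p' z), fst (p' z), F ** snd (snd (p' z))))) (at u within D)"
    unfolding \<Phi>_def
    by (intro has_derivative_Pair has_derivative_fst has_derivative_snd p'
        bounded_linear.has_derivative[OF bounded_linear_matrix_mult_right])
  moreover have "(W has_derivative W') (at (\<Phi> u) within \<Phi> ` D)"
    by (rule has_derivative_subset[of _ _ _ "Pi1 \<B> \<B>"])
       (use W' G u in \<open>auto simp: \<Phi>_def ident_eq\<close>)
  ultimately have 1: "((\<lambda>v. W (\<Phi> v)) has_derivative
      (\<lambda>z. W' (fst (p' z), fst (p' z), F ** snd (snd (p' z))))) (at u within D)"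
    by (rule has_derivative_in_compose)
  have "(\<Psi> has_derivative (\<lambda>z. (fst (snd (p' z)), fst (snd (p' z)), 0))) (at u within D)"
    unfolding \<Psi>_def
    by (intro has_derivative_Pair has_derivative_fst has_derivative_snd p' has_derivative_const)
  moreover have "(W has_derivative W') (at (\<Psi> u) within \<Psi> ` D)"
    by (rule has_derivative_subset[of _ _ _ "Pi1 \<B> \<B>"])
       (use W' G u in \<open>auto simp: \<Psi>_def ident_eq\<close>)
  ultimately have "((\<lambda>v. W (\<Psi> v)) has_derivative
      (\<lambda>z. W' (fst (snd (p' z)), fst (snd (p' z)), 0))) (at u within D)"
    by (rule has_derivative_in_compose)
  then have 2: "((\<lambda>v. W (\<Phi> v)) has_derivative
      (\<lambda>z. W' (fst (snd (p' z)), fst (snd (p' z)), 0))) (at u within D)"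
    by (rule has_derivative_transform[rotated 2]) (use G u in auto)
  have "(\<lambda>z. W' (fst (p' z), fst (p' z), F ** snd (snd (p' z)))) =
      (\<lambda>z. W' (fst (snd (p' z)), fst (snd (p' z)), 0))"
    using 1 2 unfolding at_within_open[OF u(1) D(1)] by (rule has_derivative_unique)
  then have "W' (w, w, F ** M) = W' (0, 0, 0)"
    using z by (auto simp: p'_def dest: fun_cong[of _ _ z])
  also have "\<dots> = 0"
    using linear_0[OF has_derivative_linear[OF W']] by (simp add: zero_prod_def)
  finally show ?thesis .
qed

text \<open>The coordinates \<open>c\<close> themselves are the homogenising deformation. Convexity
  of \<open>V\<close> turns a vanishing derivative into constancy.\<close>

lemma homogeneous_if_Delta_in_lie_algebroid:
  fixes W :: "jet \<Rightarrow> 'v::real_normed_vector"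
  assumes op: "open \<B>" and W: "W differentiable_on Pi1 \<B> \<B>"
    and \<A>: "immersed_submanifold (material_groupoid \<B> W) \<A>"
    and c: "diffeo_on U c" and UB: "U \<subseteq> \<B>"
    and \<Delta>: "Delta c ` (U \<times> UNIV) \<subseteq> lie_algebroid \<B> \<A>"
    and V: "open V" "convex V" "V \<subseteq> U"
  shows "homogeneous V W"
  unfolding homogeneous_iff[OF V(1)]
proof (intro exI conjI ballI)
  show cV: "diffeo_on V c"
    by (rule diffeo_on_subset[OF c V(1,3)])
  have inv: "invertible (jacobi c X)" if "X \<in> V" for X
    by (rule invertible_jacobi[OF cV that])
  fix X Y assume X: "X \<in> V" and Y: "Y \<in> V"
  have "W (X, X, F ** (matrix_inv (jacobi c Y) ** jacobi c X)) = W (Y, Y, F)"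
    if F: "invertible F" for F
  proof -
    \<comment> \<open>With this choice \<open>E ** jacobi c Y\<close> is \<open>F\<close>, so the
      material equation between \<open>X\<close> and \<open>Y\<close> becomes equality of
      \<open>W\<close> along \<open>g\<close> at \<open>X\<close> and \<open>Y\<close>.\<close>
    define E where "E = F ** matrix_inv (jacobi c Y)"
    have E: "invertible E"
      unfolding E_def using F inv[OF Y] by (intro invertible_mult invertible_matrix_inv)
    define g where "g Z = (Z, Z, E ** jacobi c Z)" for Z
    have "((\<lambda>Z. W (g Z)) has_derivative (\<lambda>h. 0)) (at Z within V)" if Z: "Z \<in> V" for Z
    proof -
      have gP: "g ` V \<subseteq> Pi1 \<B> \<B>"
        using op inv E UB V by (auto simp: g_def Pi1_iff invertible_mult)
      then obtain W' where W': "(W has_derivative W') (at (g Z) within Pi1 \<B> \<B>)"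
        using W Z by (auto simp: differentiable_on_def differentiable_def)
      have "(jacobi c has_derivative djacobi c Z) (at Z within V)"
        using cV Z jacobi_has_derivative[of V c Z]
        by (simp add: diffeo_on_def has_derivative_at_withinI)
      then have "(g has_derivative (\<lambda>h. (h, h, E ** djacobi c Z h))) (at Z within V)"
        unfolding g_def
        by (intro has_derivative_Pair has_derivative_ident
            bounded_linear.has_derivative[OF bounded_linear_matrix_mult_right])
      then have "((\<lambda>Z. W (g Z)) has_derivative (\<lambda>h. W' (h, h, E ** djacobi c Z h))) (at Z within V)"
        by (rule has_derivative_in_compose) (rule has_derivative_subset[OF W' gP])
      moreover have "W' (h, h, E ** djacobi c Z h) = 0" for h
      proof -
        have "(h, 0, matrix_inv (jacobi c Z) ** djacobi c Z h) \<in> tangent_space \<A> (ident Z)"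
          using \<Delta> Z V(3) Delta_mem_lie_algebroid_iff[OF c _ UB] by blast
        \<comment> \<open>Here the fixed matrix is \<open>E ** jacobi c Z\<close>, whose last factor
          cancels the inverse Jacobian in the tangent vector given by \<open>Delta\<close>.\<close>
        from response_constant_on_tangent[OF op W'[unfolded g_def] _ \<A> this] E inv[OF Z]
        have "W' (h, h, E ** jacobi c Z ** (matrix_inv (jacobi c Z) ** djacobi c Z h)) = 0"
          by (simp add: invertible_mult)
        moreover have "E ** jacobi c Z ** (matrix_inv (jacobi c Z) ** djacobi c Z h) = E ** djacobi c Z h"
          by (metis inv[OF Z] matrix_inv_mult(2) matrix_mul_assoc matrix_mul_rid)
        ultimately show ?thesis
          by simp
      qed
      ultimately show ?thesis
        by simp
    qed
    then have "W (g X) = W (g Y)"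
      using has_derivative_zero_constant[OF V(2), of "\<lambda>Z. W (g Z)"] X Y by metis
    moreover have "E ** jacobi c Y = F"
      by (metis E_def inv[OF Y] matrix_inv_mult(1) matrix_mul_assoc matrix_mul_rid)
    ultimately show ?thesis
      by (simp add: g_def E_def matrix_mul_assoc)
  qed
  then show "(X, Y, matrix_inv (jacobi c Y) ** jacobi c X) \<in> material_groupoid V W"
    using X Y V(1) inv by (simp add: material_groupoid_iff invertible_mult invertible_matrix_inv)
qed

section \<open>From homogeneity to the algebroid\<close>

lemma closed_range_linear:
  fixes f :: "'a::euclidean_space \<Rightarrow> 'b::euclidean_space"
  assumes "linear f"
  shows "closed (range f)"
  using assms by (intro closed_subspace linear_subspace_image) auto

text \<open>The injective derivative \<open>p'\<close> is bounded below, so that the merely continuous \<open>u\<close> is Lipschitz at \<open>x\<close>.\<close>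

lemma derivative_in_range_of_immersion:
  fixes p :: "'a::euclidean_space \<Rightarrow> 'b::euclidean_space" and \<sigma> :: "'c::real_normed_vector \<Rightarrow> 'b"
  assumes p: "(p has_derivative p') (at (u x))" and inj: "inj p'"
    and \<sigma>: "(\<sigma> has_derivative \<sigma>') (at x)" and u: "continuous (at x) u"
    and N: "open N" "x \<in> N" "\<And>y. y \<in> N \<Longrightarrow> \<sigma> y = p (u y)"
  shows "\<sigma>' w \<in> range p'"
proof -
  have lin: "linear p'" and lin': "bounded_linear \<sigma>'"
    using p \<sigma> by (auto intro: has_derivative_linear has_derivative_bounded_linear)
  obtain c where c: "c > 0" "\<And>z. c * norm z \<le> norm (p' z)"
    using linear_inj_bounded_below_pos[OF lin inj] by blast
  obtain B where B: "B > 0" "\<And>h. norm (\<sigma>' h) \<le> norm h * B"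
    using bounded_linear.pos_bounded[OF lin'] by blast
  define C where "C = 2 / c * (B + 1)"
  have C: "C > 0"
    using c B by (simp add: C_def)
  have "\<exists>y\<in>range p'. dist y (\<sigma>' w) < e" if e: "e > 0" for e
  proof -
    \<comment> \<open>The bound \<open>c / 2\<close> lets the remainder of \<open>p\<close> be
      absorbed on the left, the bound \<open>1\<close> gives the factor \<open>B + 1\<close> in
      \<open>C\<close>, and the last bound makes the final error smaller than
      \<open>e\<close>.\<close>
    define \<eta> where "\<eta> = min (c / 2) (min 1 (e / ((1 + C) * (norm w + 1))))"
    have "0 < e / ((1 + C) * (norm w + 1))"
      using e C by (intro divide_pos_pos mult_pos_pos add_nonneg_pos) auto
    then have \<eta>: "\<eta> > 0" "\<eta> \<le> c / 2" "\<eta> \<le> 1" "\<eta> \<le> e / ((1 + C) * (norm w + 1))"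
      using c(1) unfolding \<eta>_def by (auto simp only: min_less_iff_conj half_gt_zero zero_less_one min.cobounded1
          order_refl min_le_iff_disj)
    obtain d1 where d1: "d1 > 0" "\<And>y. norm (y - u x) < d1 \<Longrightarrow>
        norm (p y - p (u x) - p' (y - u x)) \<le> \<eta> * norm (y - u x)"
      using p \<eta>(1) unfolding has_derivative_at_alt by blast
    obtain d2 where d2: "d2 > 0" "\<And>y. norm (y - x) < d2 \<Longrightarrow>
        norm (\<sigma> y - \<sigma> x - \<sigma>' (y - x)) \<le> \<eta> * norm (y - x)"
      using \<sigma> \<eta>(1) unfolding has_derivative_at_alt by blast
    obtain d3 where d3: "d3 > 0" "\<And>y. dist y x < d3 \<Longrightarrow> dist (u y) (u x) < d1"
      using u d1(1) unfolding continuous_at_eps_delta by blast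
    obtain d4 where d4: "d4 > 0" "\<And>y. dist y x < d4 \<Longrightarrow> y \<in> N"
      using N(1,2) unfolding open_dist by blast
    define d where "d = min d2 (min d3 d4)"
    \<comment> \<open>Small enough for \<open>x + t *\<^sub>R w\<close> to satisfy all the
      estimates; the summand 1 covers the case \<open>w = 0\<close>.\<close>
    define t where "t = d / (2 * (norm w + 1))"
    have d: "d > 0"
      using d2 d3 d4 by (simp add: d_def)
    have t: "t > 0"
      unfolding t_def using d by (intro divide_pos_pos mult_pos_pos add_nonneg_pos) auto
    have "norm w < 2 * (norm w + 1)"
      using norm_ge_zero[of w] by (simp add: distrib_left add_nonneg_pos)
    then have "t * norm w < d"
      unfolding t_def using d by (simp add: pos_divide_less_eq add_nonneg_pos)
    define y where "y = x + t *\<^sub>R w"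
    have yx: "y - x = t *\<^sub>R w" "norm (y - x) < d" "norm (y - x) = t * norm w"
      using \<open>t * norm w < d\<close> t by (auto simp: y_def)
    have \<sigma>y: "norm (\<sigma> y - \<sigma> x - \<sigma>' (y - x)) \<le> \<eta> * norm (y - x)"
      using yx by (intro d2(2)) (simp add: d_def)
    have "norm (u y - u x) < d1"
      using d3(2)[of y] yx(2) by (simp add: d_def dist_norm)
    then have py: "norm (p (u y) - p (u x) - p' (u y - u x)) \<le> \<eta> * norm (u y - u x)"
      by (rule d1(2))
    have \<sigma>p: "\<sigma> y - \<sigma> x = p (u y) - p (u x)"
      using d4(2)[of y] yx(2) N by (simp add: d_def dist_norm)
    have "c * norm (u y - u x) \<le> norm (p' (u y - u x))"
      by (rule c(2))
    also have "\<dots> \<le> norm (\<sigma> y - \<sigma> x) + \<eta> * norm (u y - u x)"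
      using py norm_triangle_sub[of "p' (u y - u x)" "\<sigma> y - \<sigma> x"]
      by (simp add: \<sigma>p norm_minus_commute)
    also have "\<dots> \<le> norm (\<sigma> y - \<sigma> x) + c / 2 * norm (u y - u x)"
      using \<eta> by (intro add_left_mono mult_right_mono) auto
    finally have "c / 2 * norm (u y - u x) \<le> norm (\<sigma> y - \<sigma> x)"
      by simp
    also have "\<dots> \<le> norm (\<sigma>' (y - x)) + norm (\<sigma> y - \<sigma> x - \<sigma>' (y - x))"
      by (rule norm_triangle_sub)
    also have "\<dots> \<le> norm (y - x) * B + \<eta> * norm (y - x)"
      using B(2) \<sigma>y by (intro add_mono)
    also have "\<dots> \<le> (B + 1) * norm (y - x)"
      using \<eta>(3) mult_right_mono[OF \<eta>(3) norm_ge_zero[of "y - x"]] by (simp add: algebra_simps)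
    finally have uC: "norm (u y - u x) \<le> C * norm (y - x)"
      using c(1) by (simp add: C_def field_simps)
    \<comment> \<open>As \<open>\<sigma>\<close> and \<open>p \<circ> u\<close> have equal
      increments, the two linear parts differ exactly by the difference of the two
      remainders.\<close>
    have "norm (p' (u y - u x) - \<sigma>' (y - x)) =
        norm ((\<sigma> y - \<sigma> x - \<sigma>' (y - x)) - (p (u y) - p (u x) - p' (u y - u x)))"
      by (simp add: \<sigma>p)
    also have "\<dots> \<le> \<eta> * norm (y - x) + \<eta> * norm (u y - u x)"
      using norm_triangle_ineq4 \<sigma>y py by (meson add_mono order_trans)
    also have "\<dots> \<le> \<eta> * norm (y - x) + \<eta> * (C * norm (y - x))"
      using uC \<eta>(1) by simp
    also have "\<dots> = t * (\<eta> * ((1 + C) * norm w))"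
      by (simp add: yx(3) algebra_simps)
    finally have "norm (p' (u y - u x) - t *\<^sub>R \<sigma>' w) \<le> t * (\<eta> * ((1 + C) * norm w))"
      using yx(1) lin' by (simp add: bounded_linear.linear linear_cmul)
    \<comment> \<open>Division by \<open>t\<close> exhibits the element of the range of
      \<open>p'\<close> that approximates \<open>\<sigma>' w\<close>; closedness of the range then
      concludes.\<close>
    moreover have "p' (u y - u x) - t *\<^sub>R \<sigma>' w = t *\<^sub>R (p' ((1 / t) *\<^sub>R (u y - u x)) - \<sigma>' w)"
      using t linear_cmul[OF lin, of t "(1 / t) *\<^sub>R (u y - u x)"]
      by (simp only: scaleR_right_diff_distrib[of t]) simp
    ultimately have "norm (p' ((1 / t) *\<^sub>R (u y - u x)) - \<sigma>' w) \<le> \<eta> * ((1 + C) * norm w)"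
      using t by simp
    also have "\<dots> < \<eta> * ((1 + C) * (norm w + 1))"
      using \<eta>(1) C by simp
    also have "\<dots> \<le> e"
      using \<eta>(4) C by (simp add: pos_le_divide_eq add_nonneg_pos)
    finally show ?thesis
      by (auto simp: dist_norm)
  qed
  then show ?thesis
    using closed_range_linear[OF lin] closed_approachable by blast
qed

text \<open>Injectivity bounds \<open>L0\<close> from below, which keeps the preimages
  \<open>z n\<close> of \<open>y n\<close> under control once \<open>L n\<close> is close to
  \<open>L0\<close>. Hence \<open>L0 (z n)\<close> has the same limit as \<open>y n\<close>, and the
  range of \<open>L0\<close> is closed.\<close>

lemma limit_in_range_of_injective:
  fixes L :: "nat \<Rightarrow> 'a::euclidean_space \<Rightarrow> 'b::euclidean_space"
  assumes L: "\<And>n. linear (L n)" "linear L0" "inj L0" "\<And>z. (\<lambda>n. L n z) \<longlonglongrightarrow> L0 z"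
    and y: "\<And>n. y n \<in> range (L n)" "y \<longlonglongrightarrow> y0"
  shows "y0 \<in> range L0"
proof -
  have "\<exists>v. y n = L n v" for n
    using y(1)[of n] by blast
  then obtain z where z: "\<And>n. y n = L n (z n)"
    by metis
  obtain c where c: "c > 0" "\<And>z. c * norm z \<le> norm (L0 z)"
    using linear_inj_bounded_below_pos[OF L(2,3)] by blast
  \<comment> \<open>A bound for the operator norm of \<open>L n - L0\<close>; in finite dimension
    pointwise convergence on a basis makes it tend to zero.\<close>
  define S where "S n = (\<Sum>b\<in>Basis. norm (L n b - L0 b))" for n
  have S0: "S \<longlonglongrightarrow> 0"
    unfolding S_def by (intro tendsto_null_sum tendsto_norm_zero LIM_zero L(4))
  have S: "norm (L n v - L0 v) \<le> S n * norm v" for n v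
  proof -
    have lin: "linear (\<lambda>v. L n v - L0 v)"
      using L by (intro linear_compose_sub)
    have "norm (L n v - L0 v) = norm (\<Sum>b\<in>Basis. (v \<bullet> b) *\<^sub>R (L n b - L0 b))"
      using linear_sum[OF lin, of "\<lambda>b. (v \<bullet> b) *\<^sub>R b" Basis] linear_cmul[OF lin]
      by (simp add: euclidean_representation)
    also have "\<dots> \<le> (\<Sum>b\<in>Basis. \<bar>v \<bullet> b\<bar> * norm (L n b - L0 b))"
      by (rule order_trans[OF norm_sum]) simp
    also have "\<dots> \<le> (\<Sum>b\<in>Basis. norm v * norm (L n b - L0 b))"
      by (intro sum_mono mult_right_mono Basis_le_norm) auto
    finally show ?thesis
      by (simp add: S_def sum_distrib_left mult.commute)
  qed
  have "\<forall>\<^sub>F n in sequentially. S n < c / 2"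
    using c(1) by (intro order_tendstoD(2)[OF S0]) simp
  then have "\<forall>\<^sub>F n in sequentially. norm (L0 (z n) - y n) \<le> S n * (2 / c * norm (y n))"
  proof eventually_elim
    case (elim n)
    have S_nonneg: "0 \<le> S n"
      by (simp add: S_def sum_nonneg)
    have "c * norm (z n) \<le> norm (L0 (z n))"
      by (rule c)
    also have "\<dots> \<le> norm (y n) + norm (L n (z n) - L0 (z n))"
      unfolding z by (metis norm_minus_commute norm_triangle_sub)
    also have "\<dots> \<le> norm (y n) + S n * norm (z n)"
      using S by simp
    also have "\<dots> \<le> norm (y n) + c / 2 * norm (z n)"
      using elim by (intro add_left_mono mult_right_mono) auto
    finally have "norm (z n) \<le> 2 / c * norm (y n)"
      using c(1) by (simp add: field_simps)
    then have "S n * norm (z n) \<le> S n * (2 / c * norm (y n))"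
      using S_nonneg by (rule mult_left_mono)
    then show ?case
      using S[of n "z n"] by (simp add: z norm_minus_commute)
  qed
  moreover have "(\<lambda>n. S n * (2 / c * norm (y n))) \<longlonglongrightarrow> 0 * (2 / c * norm y0)"
    by (intro tendsto_intros S0 y(2))
  ultimately have "(\<lambda>n. L0 (z n) - y n) \<longlonglongrightarrow> 0"
    by (auto intro: Lim_null_comparison)
  from tendsto_add[OF this y(2)] have "(\<lambda>n. L0 (z n)) \<longlonglongrightarrow> y0"
    by simp
  then show ?thesis
    by (rule closed_sequentially[OF closed_range_linear[OF L(2)], rotated]) simp
qed

text \<open>Compact exhaustions of the chart domains split a closed ball in \<open>A\<close> into
  countably many closed pieces, each lifting to one compact set. By Baire's theorem one piece has
  interior.\<close>

lemma continuous_lift_on_open_subset: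
  fixes \<sigma> :: "'a::euclidean_space \<Rightarrow> 'b::metric_space"
    and \<P> :: "('d::euclidean_space set \<times> ('d \<Rightarrow> 'b)) set"
  assumes A: "open A" "A \<noteq> {}" and \<sigma>: "continuous_on A \<sigma>"
    and P: "countable \<P>" "\<And>D p. (D, p) \<in> \<P> \<Longrightarrow> open D \<and> continuous_on D p \<and> inj_on p D"
    and cover: "\<sigma> ` A \<subseteq> (\<Union>(D, p)\<in>\<P>. p ` D)"
  obtains V D p u where "open V" "V \<noteq> {}" "V \<subseteq> A" "(D, p) \<in> \<P>" "continuous_on V u" "u ` V \<subseteq> D"
    "\<And>x. x \<in> V \<Longrightarrow> \<sigma> x = p (u x)"
proof -
  have "\<exists>K :: nat \<Rightarrow> 'd set. open D \<longrightarrow> (\<forall>n. compact (K n) \<and> K n \<subseteq> D) \<and> (\<Union>n. K n) = D" for D :: "'d set"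
  proof (cases "open D")
    case True
    show ?thesis
    proof (rule open_Union_compact_subsets[OF True])
      fix C :: "nat \<Rightarrow> 'd set"
      assume "\<And>n. compact (C n)" "\<And>n. C n \<subseteq> D" "(\<Union>n. C n) = D"
      then show ?thesis
        by (intro exI[of _ C]) simp
    qed
  qed simp
  then have "\<forall>D :: 'd set. \<exists>K :: nat \<Rightarrow> 'd set. open D \<longrightarrow> (\<forall>n. compact (K n) \<and> K n \<subseteq> D) \<and> (\<Union>n. K n) = D"
    by (rule allI)
  from choice[OF this] obtain K where K0:
    "\<forall>D :: 'd set. open D \<longrightarrow> (\<forall>n :: nat. compact (K D n) \<and> K D n \<subseteq> D) \<and> (\<Union>n. K D n) = D" ..
  have K: "compact (K D n) \<and> K D n \<subseteq> D" "(\<Union>n. K D n) = D" if "open D" for D n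
    using K0[rule_format, OF that] by (simp_all only: )
  obtain a r where r: "r > 0" "cball a r \<subseteq> A"
    using A open_contains_cball by (metis ex_in_conv)
  define T where "T = (\<lambda>((D, p), n). {x \<in> cball a r. \<sigma> x \<in> p ` K D n})"
  have c\<sigma>: "continuous_on (cball a r) \<sigma>"
    using \<sigma> r(2) continuous_on_subset by blast
  have compact: "compact (p ` K D n)" if "(D, p) \<in> \<P>" for D p n
    using P(2)[OF that] K(1)[of D n] by (meson compact_continuous_image continuous_on_subset)
  \<comment> \<open>Otherwise the complements of the pieces would be countably many dense relatively
    open sets with empty intersection.\<close>
  have "\<exists>i\<in>\<P> \<times> UNIV. \<not> cball a r \<subseteq> closure (cball a r - T i)"
  proof (rule ccontr)
    assume *: "\<not> ?thesis"
    have "openin (top_of_set (cball a r)) (cball a r - T i) \<and> cball a r \<subseteq> closure (cball a r - T i)"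
      if i: "i \<in> \<P> \<times> UNIV" for i
    proof -
      obtain D p n where Dpn: "i = ((D, p), n)" "(D, p) \<in> \<P>"
        using i by auto
      have "T i = cball a r \<inter> \<sigma> -` (p ` K D n)"
        by (auto simp: T_def Dpn)
      then have "closed (T i)"
        using continuous_closed_preimage[OF c\<sigma> closed_cball compact_imp_closed[OF compact[OF Dpn(2), of n]]]
        by simp
      then have "openin (top_of_set (cball a r)) (cball a r - T i)"
        by (metis Diff_eq open_Compl openin_open_Int)
      then show ?thesis
        using * i by blast
    qed
    then have "cball a r \<subseteq> closure (\<Inter> ((\<lambda>i. cball a r - T i) ` (\<P> \<times> (UNIV :: nat set))))"
      using P(1) by (intro Baire closed_cball countable_image countable_SIGMA) auto
    moreover have "\<Inter> ((\<lambda>i. cball a r - T i) ` (\<P> \<times> (UNIV :: nat set))) = {}"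
    proof -
      have "\<exists>i\<in>\<P> \<times> UNIV. x \<notin> cball a r - T i" for x
      proof (cases "x \<in> cball a r")
        case True
        then obtain D p where Dp: "(D, p) \<in> \<P>" "\<sigma> x \<in> p ` D"
          using cover r(2) by blast
        then obtain n where "\<sigma> x \<in> p ` K D n"
          using K(2)[of D] P(2)[of D p] by blast
        then show ?thesis
          using True Dp by (intro bexI[of _ "((D, p), n)"]) (auto simp: T_def)
      next
        case False
        \<comment> \<open>Outside the ball any index works, but one has to exist.\<close>
        obtain z where "z \<in> \<P>"
          using cover A by blast
        then show ?thesis
          using False by (intro bexI[of _ "(z, 0)"]) auto
      qed
      then show ?thesis
        by blast
    qed
    ultimately show False
      using r(1) by auto
  qed
  then obtain D p n x where Dp: "(D, p) \<in> \<P>" and x: "x \<in> cball a r"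
      "x \<notin> closure (cball a r - T ((D, p), n))"
    by (auto simp: subset_eq)
  define N where "N = - closure (cball a r - T ((D, p), n))"
  have N: "open N" "x \<in> N" "N \<inter> cball a r \<subseteq> T ((D, p), n)"
    using x closure_subset[of "cball a r - T ((D, p), n)"] by (auto simp: N_def)
  \<comment> \<open>The point \<open>x\<close> may lie on the boundary sphere; its neighbourhood
    \<open>N\<close> still meets the open ball, which yields a set open in the whole space.\<close>
  have "x \<in> closure (ball a r)"
    using x r(1) by simp
  then have "ball a r \<inter> N \<noteq> {}"
    using N(1,2) by (metis closure_iff_nhds_not_empty subset_refl)
  define V where "V = ball a r \<inter> N"
  have V: "V \<subseteq> cball a r" "\<And>y. y \<in> V \<Longrightarrow> \<sigma> y \<in> p ` K D n"
    using N(3) by (auto simp: V_def T_def)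
  have inj: "inj_on p (K D n)"
    using P(2)[OF Dp] K(1)[of D n] inj_on_subset by blast
  \<comment> \<open>The inverse is taken on a compact set, where it is continuous for the ambient
    topology; on all of \<open>D\<close> it need not be.\<close>
  let ?u = "the_inv_into (K D n) p \<circ> \<sigma>"
  show ?thesis
  proof (rule that)
    show "open V" "V \<noteq> {}" "V \<subseteq> A" "(D, p) \<in> \<P>"
      using N(1) Dp \<open>ball a r \<inter> N \<noteq> {}\<close> V(1) r(2) by (auto simp: V_def)
    have "continuous_on (p ` K D n) (the_inv_into (K D n) p)"
      using P(2)[OF Dp] K(1)[of D n] continuous_on_subset[of D p "K D n"]
      by (intro continuous_on_inv_into inj) auto
    then show "continuous_on V ?u"
      using V continuous_on_subset[OF c\<sigma> V(1)]
      by (intro continuous_on_compose) (auto intro: continuous_on_subset)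
    show "?u ` V \<subseteq> D"
      using V(2) K(1)[of D n] P(2)[OF Dp] the_inv_into_into[OF inj _ subset_refl] by auto
    show "\<sigma> x = p (?u x)" if "x \<in> V" for x
      using V(2)[OF that] by (simp add: f_the_inv_into_f[OF inj])
  qed
qed

lemma smooth_intoD:
  assumes "smooth_into \<A> S f" "(D, p) \<in> \<A>"
  shows "openin (top_of_set S) {z \<in> S. f z \<in> p ` D}"
    and "continuous_on {z \<in> S. f z \<in> p ` D} (inv_into D p \<circ> f)"
  using assms smooth_on_imp_continuous_on unfolding smooth_into_def by fast+

section \<open>Parallelisms with values in an arbitrary Lie subgroupoid\<close>

locale parallelized_subgroupoid =
  fixes \<B> U :: "(real^3) set" and G :: "jet set" and \<A> :: "('d::euclidean_space) atlas"
    and c :: "real^3 \<Rightarrow> real^3"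
  assumes open_body: "open \<B>" and lie: "lie_subgroupoid \<B> G \<A>"
    and c: "diffeo_on U c" and U_subset: "U \<subseteq> \<B>"
    and parallelism: "\<And>X Y. X \<in> U \<Longrightarrow> Y \<in> U \<Longrightarrow>
      (X, Y, matrix_inv (jacobi c Y) ** jacobi c X) \<in> G"
begin

abbreviation "J \<equiv> jacobi c"
abbreviation "K X \<equiv> matrix_inv (jacobi c X)"

definition \<phi> :: "real^3 \<Rightarrow> real^3 \<Rightarrow> jet" where
  "\<phi> X Y = (X, Y, K Y ** J X)"

text \<open>For \<open>X\<close> in \<open>U\<close> this is the second component of
  \<open>Delta c (X, w)\<close>, by \<open>Delta_eq\<close>.\<close>

definition \<xi> :: "real^3 \<Rightarrow> real^3 \<Rightarrow> jet" where
  "\<xi> w X = (w, 0, K X ** djacobi c X w)"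

lemma open_U: "open U"
  using c by (simp add: diffeo_on_def)

lemma chart:
  assumes "(D, p) \<in> \<A>"
  shows "open D" "inj_on p D" "smooth_on D p" "p ` D \<subseteq> G"
    and "u \<in> D \<Longrightarrow> (p has_derivative frechet_derivative p (at u)) (at u)"
    and "u \<in> D \<Longrightarrow> inj (frechet_derivative p (at u))"
proof -
  have im: "immersed_submanifold G \<A>"
    using lie by (simp add: lie_subgroupoid_def)
  show "open D" "inj_on p D" "smooth_on D p" "p ` D \<subseteq> G"
    "u \<in> D \<Longrightarrow> inj (frechet_derivative p (at u))"
    using im assms unfolding immersed_submanifold_def by fast+
  then show "u \<in> D \<Longrightarrow> (p has_derivative frechet_derivative p (at u)) (at u)"
    using smooth_on_imp_has_derivative by blast
qed

lemma charts_cover: "(\<Union>(D, p)\<in>\<A>. p ` D) = G"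
  using lie by (simp add: lie_subgroupoid_def immersed_submanifold_def)

lemma \<phi>_in_G: "X \<in> U \<Longrightarrow> Y \<in> U \<Longrightarrow> \<phi> X Y \<in> G"
  by (simp add: \<phi>_def parallelism)

lemma \<phi>_self: "X \<in> U \<Longrightarrow> \<phi> X X = ident X"
  by (simp add: \<phi>_def ident_eq matrix_inv_mult invertible_jacobi[OF c])

lemma \<phi>_comp:
  assumes "Y \<in> U"
  shows "jet_comp (\<phi> Y Z) (\<phi> X Y) = \<phi> X Z"
proof -
  have "K Z ** J Y ** (K Y ** J X) = K Z ** (J Y ** K Y) ** J X"
    by (simp only: matrix_mul_assoc)
  then show ?thesis
    by (simp add: \<phi>_def matrix_inv_mult(2)[OF invertible_jacobi[OF c assms]])
qed

lemma \<phi>_has_derivative: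
  assumes "X \<in> U"
  shows "((\<lambda>Z. \<phi> Z X) has_derivative (\<lambda>w. \<xi> w X)) (at X)"
proof -
  have "(J has_derivative djacobi c X) (at X)"
    using c assms by (intro jacobi_has_derivative[of U]) (auto simp: diffeo_on_def)
  then show ?thesis
    unfolding \<phi>_def \<xi>_def
    by (intro has_derivative_Pair has_derivative_ident has_derivative_const
        bounded_linear.has_derivative[OF bounded_linear_matrix_mult_right])
qed

lemma continuous_on_\<phi>: "continuous_on U (\<lambda>X. \<phi> X Y)"
  unfolding \<phi>_def
  using smooth_on_imp_continuous_on_jacobi[OF open_U] c
  by (intro continuous_on_Pair continuous_on_id continuous_on_const
      bounded_linear.continuous_on[OF bounded_linear_matrix_mult_right]) (simp add: diffeo_on_def)

lemma continuous_on_\<xi>: "continuous_on U (\<xi> w)"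
proof -
  have "continuous_on U K"
    using differentiable_imp_continuous_within[OF matrix_inv_jacobi_differentiable[OF c]]
    by (rule continuous_at_imp_continuous_on[OF ballI])
  moreover have "continuous_on U (\<lambda>X. djacobi c X w)"
    using c by (intro continuous_on_djacobi) (auto simp: diffeo_on_def)
  ultimately show ?thesis
    unfolding \<xi>_def
    by (intro continuous_on_Pair continuous_on_const
        bounded_bilinear.continuous_on[OF bounded_bilinear_matrix_mult])
qed

text \<open>The chart around the identities is fixed beforehand, so that tangency at the points
  found for different sets \<open>A\<close> can later be passed to a limit within that one
  chart.\<close>

lemma \<xi>_in_range_dense:
  assumes Dp: "(D, p) \<in> \<A>" and A: "open A" "A \<noteq> {}" "A \<subseteq> U" "ident ` A \<subseteq> p ` D"
  obtains X where "X \<in> A" "\<xi> w X \<in> range (frechet_derivative p (at (inv_into D p (ident X))))"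
proof -
  obtain X0 where X0: "X0 \<in> A"
    using A by blast
  have "countable \<A>"
    using lie by (simp add: lie_subgroupoid_def immersed_submanifold_def)
  moreover have "open E \<and> continuous_on E q \<and> inj_on q E" if "(E, q) \<in> \<A>" for E q
    using chart[OF that] smooth_on_imp_continuous_on by blast
  moreover have "(\<lambda>X. \<phi> X X0) ` A \<subseteq> (\<Union>(E, q)\<in>\<A>. q ` E)"
    unfolding charts_cover using X0 A(3) \<phi>_in_G by blast
  \<comment> \<open>The lift lands in some chart \<open>(E, q)\<close> that may be unrelated to
    \<open>(D, p)\<close>; multiplication in the groupoid is what connects the two.\<close>
  ultimately obtain V E q u where V: "open V" "V \<noteq> {}" "V \<subseteq> A" and Eq: "(E, q) \<in> \<A>"
    and u: "continuous_on V u" "u ` V \<subseteq> E" "\<And>X. X \<in> V \<Longrightarrow> \<phi> X X0 = q (u X)"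
    using continuous_lift_on_open_subset[OF A(1,2) continuous_on_subset[OF continuous_on_\<phi> A(3)], of \<A> X0]
    by metis
  obtain X1 where X1: "X1 \<in> V"
    using V by blast
  have U: "X0 \<in> U" "X1 \<in> U" "V \<subseteq> U"
    using X0 X1 V A by auto
  \<comment> \<open>\<open>v\<close> is a parameter of the fixed left factor: multiplying
    \<open>\<phi> X X0\<close> by it on the left gives \<open>\<phi> X X1\<close>, which is the
    identity at \<open>X = X1\<close>.\<close>
  obtain D' p' v where Dp': "(D', p') \<in> \<A>" and v: "v \<in> D'" "p' v = \<phi> X0 X1"
    using \<phi>_in_G[OF U(1,2)] charts_cover by fastforce
  define S where "S = {(a, b). a \<in> D' \<and> b \<in> E \<and> source (p' a) = target (q b)}"
  define f where "f = (\<lambda>(a, b). jet_comp (p' a) (q b))"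
  have "smooth_into \<A> S f"
    using lie Dp' Eq unfolding lie_subgroupoid_def S_def f_def by fast
  note f = smooth_intoD[OF this Dp]
  define T where "T = {z \<in> S. f z \<in> p ` D}"
  have S: "(v, u X) \<in> S" and f\<phi>: "f (v, u X) = \<phi> X X1" if "X \<in> V" for X
  proof -
    show "(v, u X) \<in> S"
      using u(2) u(3)[OF that, symmetric] that v by (auto simp: S_def \<phi>_def)
    show "f (v, u X) = \<phi> X X1"
      using u(3)[OF that, symmetric] v \<phi>_comp[OF U(1)] by (simp add: f_def)
  qed
  have pair: "continuous_on V (\<lambda>X. (v, u X))"
    by (intro continuous_on_Pair continuous_on_const u(1))
  \<comment> \<open>The points at which the product lies in the chart \<open>(D, p)\<close>. This
    set is open by smoothness of the multiplication into the atlas and contains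
    \<open>X1\<close>.\<close>
  define N where "N = V \<inter> (\<lambda>X. (v, u X)) -` T"
  have "openin (top_of_set V) N"
    unfolding N_def T_def using f(1) S by (intro continuous_openin_preimage[OF pair]) auto
  then have N: "open N" "N \<subseteq> V"
    using V(1) by (auto simp: openin_open_eq)
  have "X1 \<in> N"
    using X1 S[OF X1] f\<phi>[OF X1] \<phi>_self[OF U(2)] A(4) V(3) by (auto simp: N_def T_def)
  define u' where "u' X = inv_into D p (\<phi> X X1)" for X
  have "continuous_on N (\<lambda>X. (inv_into D p \<circ> f) (v, u X))"
    by (rule continuous_on_compose2[OF f(2) continuous_on_subset[OF pair N(2)]])
      (auto simp: N_def T_def)
  then have "continuous_on N u'"
    by (rule continuous_on_eq) (use f\<phi> N(2) in \<open>auto simp: u'_def\<close>)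
  then have cu': "continuous (at X1) u'"
    using N(1) \<open>X1 \<in> N\<close> continuous_on_eq_continuous_at by blast
  have pD: "\<phi> X X1 \<in> p ` D" if "X \<in> N" for X
    using that f\<phi> by (auto simp: N_def T_def)
  have u'1: "u' X1 = inv_into D p (ident X1)" "u' X1 \<in> D"
    using pD[OF \<open>X1 \<in> N\<close>] \<phi>_self[OF U(2)] inv_into_into[of _ p D] by (auto simp: u'_def)
  have "\<xi> w X1 \<in> range (frechet_derivative p (at (u' X1)))"
  proof (rule derivative_in_range_of_immersion[OF _ _ \<phi>_has_derivative[OF U(2)] cu' N(1) \<open>X1 \<in> N\<close>])
    show "\<phi> X X1 = p (u' X)" if "X \<in> N" for X
      using pD[OF that] by (simp add: u'_def f_inv_into_f)
  qed (use chart[OF Dp] u'1 in auto)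
  then show ?thesis
    using that[of X1] X1 V(3) u'1(1) by auto
qed

lemma \<xi>_in_tangent_space:
  assumes X0: "X0 \<in> U"
  shows "\<xi> w X0 \<in> tangent_space \<A> (ident X0)"
proof -
  have "ident X0 \<in> G"
    using \<phi>_in_G[OF X0 X0] \<phi>_self[OF X0] by simp
  then obtain D p where Dp: "(D, p) \<in> \<A>" and X0D: "ident X0 \<in> p ` D"
    using charts_cover by blast
  define u where "u = inv_into D p \<circ> ident"
  \<comment> \<open>Openness comes from smoothness of \<open>ident\<close> into the atlas: the image
    of \<open>D\<close> under \<open>p\<close> need not be open in the subspace topology of
    \<open>G\<close>.\<close>
  define N where "N = U \<inter> {X \<in> \<B>. ident X \<in> p ` D}"
  have "smooth_into \<A> \<B> ident"
    using lie by (simp add: lie_subgroupoid_def)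
  note ident = smooth_intoD[OF this Dp]
  have N: "open N" "X0 \<in> N" "N \<subseteq> U"
    using ident(1) open_body open_U X0 U_subset X0D by (auto simp: N_def openin_open_eq)
  have u: "continuous_on N u" "u ` N \<subseteq> D"
    unfolding u_def using continuous_on_subset[OF ident(2)]
    by (auto simp: N_def intro: inv_into_into)
  \<comment> \<open>Density on shrinking balls gives points \<open>X n\<close> tending to
    \<open>X0\<close> at which the vector is tangent, all seen in the chart
    \<open>(D, p)\<close>.\<close>
  have "\<exists>X \<in> ball X0 (1 / Suc n) \<inter> N. \<xi> w X \<in> range (frechet_derivative p (at (u X)))" for n
  proof (rule \<xi>_in_range_dense[OF Dp])
    show "open (ball X0 (1 / Suc n) \<inter> N)" "ball X0 (1 / Suc n) \<inter> N \<subseteq> U"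
      "ident ` (ball X0 (1 / Suc n) \<inter> N) \<subseteq> p ` D"
      using N by (auto simp: N_def)
    show "ball X0 (1 / Suc n) \<inter> N \<noteq> {}"
      using N(2) by (auto simp: disjoint_iff intro!: exI[of _ X0])
  qed (auto simp: u_def)
  then obtain X where X: "\<And>n. X n \<in> ball X0 (1 / Suc n)" "\<And>n. X n \<in> N"
      "\<And>n. \<xi> w (X n) \<in> range (frechet_derivative p (at (u (X n))))"
    by (metis Int_iff)
  have "(\<lambda>n. dist (X n) X0) \<longlonglongrightarrow> 0"
  proof (rule Lim_null_comparison[OF always_eventually LIMSEQ_inverse_real_of_nat], rule allI)
    show "norm (dist (X n) X0) \<le> inverse (real (Suc n))" for n
      using X(1)[of n] by (simp add: dist_commute inverse_eq_divide)
  qed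
  then have "X \<longlonglongrightarrow> X0"
    by (rule tendsto_dist_iff[THEN iffD2])
  have lim: "(\<lambda>n. h (X n)) \<longlonglongrightarrow> h X0" if "continuous_on N h" for h :: "real^3 \<Rightarrow> 'e::topological_space"
    using that N X(2) \<open>X \<longlonglongrightarrow> X0\<close> continuous_on_tendsto_compose[of N h X X0] by simp
  have "\<xi> w X0 \<in> range (frechet_derivative p (at (u X0)))"
  proof (rule limit_in_range_of_injective)
    show "\<xi> w (X n) \<in> range (frechet_derivative p (at (u (X n))))" for n
      by (rule X)
    show "(\<lambda>n. \<xi> w (X n)) \<longlonglongrightarrow> \<xi> w X0"
      using lim continuous_on_subset[OF continuous_on_\<xi> N(3)] by blast
    show "(\<lambda>n. frechet_derivative p (at (u (X n))) z) \<longlonglongrightarrow> frechet_derivative p (at (u X0)) z" for z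
    proof -
      have "continuous_on D (\<lambda>x. frechet_derivative p (at x) z)"
        using chart[OF Dp] smooth_on_imp_continuous_on smooth_on_frechet_derivative by blast
      then have "continuous_on N (\<lambda>X. frechet_derivative p (at (u X)) z)"
        using u continuous_on_compose2 by blast
      from lim[OF this] show ?thesis .
    qed
    show "linear (frechet_derivative p (at (u (X n))))" for n
      using chart(5)[OF Dp] u(2) X(2) has_derivative_linear by blast
    show "linear (frechet_derivative p (at (u X0)))"
      using chart(5)[OF Dp] u(2) N(2) has_derivative_linear by blast
    show "inj (frechet_derivative p (at (u X0)))"
      using chart(6)[OF Dp] u(2) N(2) by blast
  qed
  moreover have "u X0 \<in> D" "p (u X0) = ident X0"
    using u(2) N(2) X0D by (auto simp: u_def f_inv_into_f)
  ultimately show ?thesis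
    unfolding tangent_space_def using Dp by fast
qed

end

section \<open>Local homogeneity in terms of the section \<open>Delta\<close>\<close>

theorem proposition5p4:
  fixes \<B> :: "(real^3) set"
    and W :: "jet \<Rightarrow> 'v::real_normed_vector"
    and \<A> :: "('d::euclidean_space) atlas"
  assumes "body \<B> W"
    and "uniform \<B> W"
    and "lie_subgroupoid \<B> (material_groupoid \<B> W) \<A>"
  shows "locally_homogeneous \<B> W \<longleftrightarrow>
    (\<forall>x\<in>\<B>. \<exists>U c. open U \<and> U \<subseteq> \<B> \<and> x \<in> U \<and> local_coordinates U c \<and>
       Delta c ` (U \<times> UNIV) \<subseteq> lie_algebroid \<B> \<A>)"
proof
  have op: "open \<B>" and W: "W differentiable_on Pi1 \<B> \<B>"
    using assms(1) by (auto simp: body_def)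
  {
    assume "locally_homogeneous \<B> W"
    then obtain \<U> where \<U>: "\<Union>\<U> = \<B>" "\<And>U. U \<in> \<U> \<Longrightarrow> open U \<and> homogeneous U W"
      unfolding locally_homogeneous_def by blast
    show "\<forall>x\<in>\<B>. \<exists>U c. open U \<and> U \<subseteq> \<B> \<and> x \<in> U \<and> local_coordinates U c \<and>
       Delta c ` (U \<times> UNIV) \<subseteq> lie_algebroid \<B> \<A>"
    proof
      fix x assume "x \<in> \<B>"
      then obtain U where U: "x \<in> U" "open U" "homogeneous U W" "U \<subseteq> \<B>"
        using \<U> by blast
      then obtain c where c: "diffeo_on U c" "\<And>X Y. X \<in> U \<Longrightarrow> Y \<in> U \<Longrightarrow>
          (X, Y, matrix_inv (jacobi c Y) ** jacobi c X) \<in> material_groupoid U W"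
        unfolding homogeneous_iff[OF U(2)] by blast
      interpret parallelized_subgroupoid \<B> U "material_groupoid \<B> W" \<A> c
      proof
        \<comment> \<open>The matrix form of the material equation does not mention the domain of
          the deformations, so material isomorphisms of \<open>U\<close> are material isomorphisms
          of the body.\<close>
        show "(X, Y, matrix_inv (jacobi c Y) ** jacobi c X) \<in> material_groupoid \<B> W"
          if "X \<in> U" "Y \<in> U" for X Y
          using c(2)[OF that] U(2,4) op by (auto simp: material_groupoid_iff)
      qed (use op assms(3) c(1) U(4) in auto)
      have "Delta c (X, w) \<in> lie_algebroid \<B> \<A>" if "X \<in> U" for X w
        using \<xi>_in_tangent_space[OF that, of w] Delta_mem_lie_algebroid_iff[OF c(1) that U(4), of w \<A>]
        by (simp add: \<xi>_def)
      then show "\<exists>U c. open U \<and> U \<subseteq> \<B> \<and> x \<in> U \<and> local_coordinates U c \<and>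
          Delta c ` (U \<times> UNIV) \<subseteq> lie_algebroid \<B> \<A>"
        using U c(1) unfolding local_coordinates_def by blast
    qed
  }
  assume R: "\<forall>x\<in>\<B>. \<exists>U c. open U \<and> U \<subseteq> \<B> \<and> x \<in> U \<and> local_coordinates U c \<and>
       Delta c ` (U \<times> UNIV) \<subseteq> lie_algebroid \<B> \<A>"
  have im: "immersed_submanifold (material_groupoid \<B> W) \<A>"
    using assms(3) by (simp add: lie_subgroupoid_def)
  have "\<exists>V. x \<in> V \<and> V \<subseteq> \<B> \<and> open V \<and> homogeneous V W" if x: "x \<in> \<B>" for x
  proof -
    obtain U c where U: "open U" "U \<subseteq> \<B>" "x \<in> U" "diffeo_on U c"
      "Delta c ` (U \<times> UNIV) \<subseteq> lie_algebroid \<B> \<A>"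
      using bspec[OF R x] unfolding local_coordinates_def by blast
    then obtain r where r: "r > 0" "ball x r \<subseteq> U"
      using open_contains_ball by blast
    \<comment> \<open>A ball is used for its convexity; \<open>U\<close> itself might be
      disconnected.\<close>
    have "homogeneous (ball x r) W"
      by (rule homogeneous_if_Delta_in_lie_algebroid[OF op W im U(4,2,5) open_ball convex_ball r(2)])
    then show ?thesis
      using r U(2) by (intro exI[of _ "ball x r"]) auto
  qed
  then show "locally_homogeneous \<B> W"
    unfolding locally_homogeneous_def
    by (intro exI[of _ "{V. V \<subseteq> \<B> \<and> open V \<and> homogeneous V W}"]) blast
qed

end
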